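(* For every completely regular frame $L$, the $\sigma$-frame $\mathrm{Coz}_c[L]=\{\mathrm{coz}(\alpha)\mid \alpha\in\mathcal C_c(L)\}$ (with the order inherited from $L$) is regular.
   Context: Let $L$ be a frame with top $\top$ and bottom $\bot$. The frame of reals $\mathcal L(\mathbb R)$ is generated by pairs $(p,q)$, $p,q\in\mathbb Q$, subject to: (R1) $(p,q)\wedge(r,s)=(p\vee r,q\wedge s)$; (R2) $(p,q)\vee(r,s)=(p,s)$ whenever $p\le r<q\le s$; (R3) $(p,q)=\bigvee\{(r,s)\mid p<r<s<q\}$; (R4) $\top=\bigvee\{(p,q)\mid p,q\in\mathbb Q\}$. $\mathcal R(L)$ is the set of frame homomorphisms $\mathcal L(\mathbb R)\to L$; it is an $f$-ring with operations, for $\diamond\in\{+,\cdot,\wedge,\vee\}$, $(\alpha\diamond\beta)(p,q)=\bigvee\{\alpha(r,s)\wedge\beta(u,v)\mid \langle r,s\rangle\diamond\langle u,v\rangle\subseteq\langle p,q\rangle\}$, where $\langle p,q\rangle=\{t\in\mathbb R\mid p<t<q\}$. For $r\in\mathbb R$, the constant $\mathbf r\in\mathcal R(L)$ satisfies $\mathbf r(p,q)=\top$ if $p<r<q$ and $\bot$ otherwise; $\alpha-r$ means $\alpha-\mathbf r$. Put $(p,-)=\bigvee_{r,s>p}(r,s)$ and $(-,q)=\bigvee_{r,s<q}(r,s)$ (with $r,s\in\mathbb Q$). The cozero element of $\alpha$ is $\mathrm{coz}(\alpha)=\alpha(-,0)\vee\alpha(0,-)$. Put $R_\alpha=\{r\in\mathbb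 R\mid \mathrm{coz}(\alpha-r)\ne\top\}$ and $\mathcal C_c(L)=\{\alpha\in\mathcal R(L)\mid R_\alpha\text{ is countable}\}$ (countable includes finite). $L$ is completely regular iff every element of $L$ is the join of elements of the form $\mathrm{coz}(\alpha)$, $\alpha\in\mathcal R(L)$. A $\sigma$-frame is a distributive lattice $M$ in which every countable subset has a join and $a\wedge\bigvee S=\bigvee_{s\in S}(a\wedge s)$ for all $a\in M$ and countable $S\subseteq M$. In a $\sigma$-frame $M$ with top $\top$ and bottom $\bot$, $a\prec b$ means that there is $x\in M$ with $a\wedge x=\bot$ and $x\vee b=\top$. $M$ is regular if for every $a\in M$ there is a sequence $(a_n)_{n=1}^\infty$ in $M$ with $a_n\prec a$ for every $n$ and $a=\bigvee_{n=1}^\infty a_n$. *)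

theory Defs
  imports Complex_Main "HOL-Library.Countable_Set" "HOL-Algebra.Lattice"
begin

text \<open>The order-theoretic operations of HOL-Algebra are only used below through their symbolic
  notation with an explicit structure; the plain names denote the type-class operations.\<close>

hide_const (open) Lattice.sup Lattice.inf Order.top Order.bottom

section \<open>Frames\<close>

class frame = complete_lattice +
  assumes inf_Sup_frame: "inf a (Sup S) = Sup ((\<lambda>s. inf a s) ` S)"

definition frame_hom :: "('a::frame \<Rightarrow> 'b::frame) \<Rightarrow> bool" where
  "frame_hom h \<longleftrightarrow>
     (\<forall>S. h (Sup S) = Sup (h ` S)) \<and> (\<forall>x y. h (inf x y) = inf (h x) (h y)) \<and> h top = top"

section \<open>The frame of reals\<close>

text \<open>The relations (R1)--(R4), for a family of elements indexed by pairs of rationals.\<close>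

definition real_relations :: "(rat \<Rightarrow> rat \<Rightarrow> 'a::frame) \<Rightarrow> bool" where
  "real_relations f \<longleftrightarrow>
     (\<forall>p q r s. inf (f p q) (f r s) = f (max p r) (min q s)) \<and>
     (\<forall>p q r s. p \<le> r \<and> r < q \<and> q \<le> s \<longrightarrow> sup (f p q) (f r s) = f p s) \<and>
     (\<forall>p q. f p q = Sup {f r s | r s. p < r \<and> r < s \<and> s < q}) \<and>
     top = Sup {f p q | p q. True}"

text \<open>The frame presented by generators \<open>(p,q)\<close> and these relations is realised by the sets of
  generators that are closed under them: a set \<open>U\<close> stands for the join of its members. By (R1)
  the generators form a meet-semilattice, so every element is a join of generators.
  The theorems \<open>real_relations_rgen\<close> and \<open>frame_of_reals_universal\<close> below establish that this is
  the frame with the required presentation.\<close>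

definition reals_ideal :: "(rat \<times> rat) set \<Rightarrow> bool" where
  "reals_ideal U \<longleftrightarrow>
     (\<forall>p q r s. (p, q) \<in> U \<and> p \<le> r \<and> s \<le> q \<longrightarrow> (r, s) \<in> U) \<and>
     (\<forall>p q r s. (p, q) \<in> U \<and> (r, s) \<in> U \<and> p \<le> r \<and> r < q \<and> q \<le> s \<longrightarrow> (p, s) \<in> U) \<and>
     (\<forall>p q. (\<forall>r s. p < r \<and> r < s \<and> s < q \<longrightarrow> (r, s) \<in> U) \<longrightarrow> (p, q) \<in> U)"

definition reals_closure :: "(rat \<times> rat) set \<Rightarrow> (rat \<times> rat) set" where
  "reals_closure X = \<Inter> {U. reals_ideal U \<and> X \<subseteq> U}"

lemma reals_idealD1: "reals_ideal U \<Longrightarrow> (p, q) \<in> U \<Longrightarrow> p \<le> r \<Longrightarrow> s \<le> q \<Longrightarrow> (r, s) \<in> U"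
  unfolding reals_ideal_def by blast

lemma reals_idealD2:
  "reals_ideal U \<Longrightarrow> (p, q) \<in> U \<Longrightarrow> (r, s) \<in> U \<Longrightarrow> p \<le> r \<Longrightarrow> r < q \<Longrightarrow> q \<le> s \<Longrightarrow> (p, s) \<in> U"
  unfolding reals_ideal_def by blast

lemma reals_idealD3:
  "reals_ideal U \<Longrightarrow> (\<And>r s. p < r \<Longrightarrow> r < s \<Longrightarrow> s < q \<Longrightarrow> (r, s) \<in> U) \<Longrightarrow> (p, q) \<in> U"
  unfolding reals_ideal_def by blast

lemma reals_idealI:
  assumes "\<And>p q r s. (p, q) \<in> U \<Longrightarrow> p \<le> r \<Longrightarrow> s \<le> q \<Longrightarrow> (r, s) \<in> U"
    and "\<And>p q r s. (p, q) \<in> U \<Longrightarrow> (r, s) \<in> U \<Longrightarrow> p \<le> r \<Longrightarrow> r < q \<Longrightarrow> q \<le> s \<Longrightarrow> (p, s) \<in> U"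
    and "\<And>p q. (\<And>r s. p < r \<Longrightarrow> r < s \<Longrightarrow> s < q \<Longrightarrow> (r, s) \<in> U) \<Longrightarrow> (p, q) \<in> U"
  shows "reals_ideal U"
  unfolding reals_ideal_def
proof (intro conjI allI impI)
  show "(p, q) \<in> U \<and> p \<le> r \<and> s \<le> q \<Longrightarrow> (r, s) \<in> U" for p q r s
    using assms(1) by blast
  show "(p, q) \<in> U \<and> (r, s) \<in> U \<and> p \<le> r \<and> r < q \<and> q \<le> s \<Longrightarrow> (p, s) \<in> U" for p q r s
    using assms(2) by blast
  show "\<forall>r s. p < r \<and> r < s \<and> s < q \<longrightarrow> (r, s) \<in> U \<Longrightarrow> (p, q) \<in> U" for p q
    using assms(3) by blast
qed

lemma reals_ideal_Inter: "(\<And>U. U \<in> S \<Longrightarrow> reals_ideal U) \<Longrightarrow> reals_ideal (\<Inter> S)"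
proof (rule reals_idealI, goal_cases)
  case (1 p q r s) then show ?case by (auto dest: reals_idealD1)
next
  case (2 p q r s)
  then show ?case by (meson InterD InterI reals_idealD2)
next
  case (3 p q)
  show ?case
  proof
    fix U assume "U \<in> S"
    then show "(p, q) \<in> U" using 3 by - (rule reals_idealD3[of U p q], auto)
  qed
qed

lemma reals_ideal_closure: "reals_ideal (reals_closure X)"
  unfolding reals_closure_def by (rule reals_ideal_Inter) auto

lemma subset_reals_closure: "X \<subseteq> reals_closure X"
  unfolding reals_closure_def by auto

lemma reals_closure_least: "reals_ideal U \<Longrightarrow> X \<subseteq> U \<Longrightarrow> reals_closure X \<subseteq> U"
  unfolding reals_closure_def by auto

lemma reals_ideal_UNIV: "reals_ideal UNIV"
  by (rule reals_idealI) auto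

typedef frame_of_reals = "{U. reals_ideal U}"
  using reals_ideal_UNIV by blast

setup_lifting type_definition_frame_of_reals

lemma reals_ideal_Rep: "reals_ideal (Rep_frame_of_reals A)"
  using Rep_frame_of_reals by simp

instantiation frame_of_reals :: complete_lattice
begin

lift_definition less_eq_frame_of_reals :: "frame_of_reals \<Rightarrow> frame_of_reals \<Rightarrow> bool"
  is "(\<subseteq>)" .

lift_definition less_frame_of_reals :: "frame_of_reals \<Rightarrow> frame_of_reals \<Rightarrow> bool"
  is "(\<subset>)" .

lift_definition Inf_frame_of_reals :: "frame_of_reals set \<Rightarrow> frame_of_reals" is "\<lambda>S. \<Inter> S"
  by (rule reals_ideal_Inter) auto

lift_definition Sup_frame_of_reals :: "frame_of_reals set \<Rightarrow> frame_of_reals"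
  is "\<lambda>S. reals_closure (\<Union> S)"
  by (rule reals_ideal_closure)

lift_definition inf_frame_of_reals :: "frame_of_reals \<Rightarrow> frame_of_reals \<Rightarrow> frame_of_reals"
  is "\<lambda>U V. U \<inter> V"
  using reals_ideal_Inter[of "{U, V}" for U V] by auto

lift_definition sup_frame_of_reals :: "frame_of_reals \<Rightarrow> frame_of_reals \<Rightarrow> frame_of_reals"
  is "\<lambda>U V. reals_closure (U \<union> V)"
  by (rule reals_ideal_closure)

lift_definition top_frame_of_reals :: frame_of_reals is UNIV
  by (rule reals_ideal_UNIV)

lift_definition bot_frame_of_reals :: frame_of_reals is "reals_closure {}"
  by (rule reals_ideal_closure)

instance
proof
  fix x y z :: frame_of_reals and A :: "frame_of_reals set"
  show "x < y \<longleftrightarrow> x \<le> y \<and> \<not> y \<le> x" by transfer auto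
  show "x \<le> x" by transfer auto
  show "x \<le> y \<Longrightarrow> y \<le> z \<Longrightarrow> x \<le> z" by transfer auto
  show "x \<le> y \<Longrightarrow> y \<le> x \<Longrightarrow> x = y" by transfer auto
  show "inf x y \<le> x" "inf x y \<le> y" by (transfer, auto)+
  show "x \<le> y \<Longrightarrow> x \<le> z \<Longrightarrow> x \<le> inf y z" by transfer auto
  show "x \<le> sup x y" "y \<le> sup x y" by (transfer, use subset_reals_closure in blast)+
  show "y \<le> x \<Longrightarrow> z \<le> x \<Longrightarrow> sup y z \<le> x" by transfer (simp add: reals_closure_least)
  show "x \<in> A \<Longrightarrow> Inf A \<le> x" by transfer auto
  show "(\<And>x. x \<in> A \<Longrightarrow> z \<le> x) \<Longrightarrow> z \<le> Inf A" by transfer auto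
  show "x \<in> A \<Longrightarrow> x \<le> Sup A" by transfer (use subset_reals_closure in blast)
  show "(\<And>x. x \<in> A \<Longrightarrow> x \<le> z) \<Longrightarrow> Sup A \<le> z"
    by transfer (rule reals_closure_least, assumption, blast)
  show "Inf {} = (top :: frame_of_reals)" by transfer auto
  show "Sup {} = (bot :: frame_of_reals)" by transfer auto
qed

end

lemma reals_ideal_residual:
  assumes U: "reals_ideal U" and V: "reals_ideal V"
  shows "reals_ideal {(p, q). \<forall>r s. (r, s) \<in> U \<longrightarrow> (max p r, min q s) \<in> V}"
proof (rule reals_idealI, goal_cases)
  case (1 p q r s)
  show ?case
  proof (clarsimp)
    fix a b assume "(a, b) \<in> U"
    with 1 have "(max p a, min q b) \<in> V" by auto
    then show "(max r a, min s b) \<in> V"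
      by (rule reals_idealD1[OF V]) (use 1 in auto)
  qed
next
  case (2 p q r s)
  note rq = \<open>p \<le> r\<close> \<open>r < q\<close> \<open>q \<le> s\<close>
  show ?case
  proof (clarsimp)
    fix a b assume ab: "(a, b) \<in> U"
    have pq: "(max p a, min q b) \<in> V" and rs: "(max r a, min s b) \<in> V" using 2 ab by auto
    show "(max p a, min s b) \<in> V"
    proof (cases "max r a < min q b")
      case True
      then show ?thesis
        by - (rule reals_idealD2[OF V pq rs]; use rq in auto)
    next
      case False
      then consider "b \<le> a" | "b \<le> r" | "q \<le> a" using rq by (auto simp: not_less max_def min_def split: if_splits)
      then show ?thesis
      proof cases
        case 1
        then show ?thesis by - (rule reals_idealD3[OF V], auto)
      next
        case 2
        then show ?thesis by - (rule reals_idealD1[OF V pq]; use rq in auto)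
      next
        case 3
        then show ?thesis by - (rule reals_idealD1[OF V rs]; use rq in auto)
      qed
    qed
  qed
next
  case (3 p q)
  show ?case
  proof (clarsimp)
    fix a b assume ab: "(a, b) \<in> U"
    show "(max p a, min q b) \<in> V"
    proof (rule reals_idealD3[OF V])
      fix r s assume rs: "max p a < r" "r < s" "s < min q b"
      have "\<forall>c d. (c, d) \<in> U \<longrightarrow> (max r c, min s d) \<in> V" using 3[of r s] rs by simp
      with ab have "(max r a, min s b) \<in> V" by blast
      moreover have "max r a = r" "min s b = s" using rs by auto
      ultimately show "(r, s) \<in> V" by simp
    qed
  qed
qed

instance frame_of_reals :: frame
proof
  fix A :: frame_of_reals and S :: "frame_of_reals set"
  show "inf A (Sup S) = Sup (inf A ` S)"
  proof (rule antisym)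
    show "Sup (inf A ` S) \<le> inf A (Sup S)"
      by (auto intro!: Sup_least intro: le_infI2 Sup_upper)
    show "inf A (Sup S) \<le> Sup (inf A ` S)"
    proof -
      let ?A = "Rep_frame_of_reals A" and ?S = "Rep_frame_of_reals ` S"
      let ?V = "reals_closure (\<Union> (Rep_frame_of_reals ` inf A ` S))"
      let ?W = "{(p, q). \<forall>r s. (r, s) \<in> ?A \<longrightarrow> (max p r, min q s) \<in> ?V}"
      have "reals_closure (\<Union> ?S) \<subseteq> ?W"
      proof (rule reals_closure_least)
        show "reals_ideal ?W" by (rule reals_ideal_residual[OF reals_ideal_Rep reals_ideal_closure])
        have "(max p r, min q s) \<in> ?V"
          if "(p, q) \<in> Rep_frame_of_reals B" "B \<in> S" "(r, s) \<in> ?A" for p q r s B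
        proof -
          have "(max p r, min q s) \<in> Rep_frame_of_reals B"
            by (rule reals_idealD1[OF reals_ideal_Rep that(1)]) auto
          moreover have "(max p r, min q s) \<in> ?A"
            by (rule reals_idealD1[OF reals_ideal_Rep that(3)]) auto
          ultimately have "(max p r, min q s) \<in> \<Union> (Rep_frame_of_reals ` inf A ` S)"
            using that(2) by (auto simp: inf_frame_of_reals.rep_eq)
          then show ?thesis by (rule subsetD[OF subset_reals_closure])
        qed
        then show "\<Union> ?S \<subseteq> ?W" by blast
      qed
      then have "?A \<inter> reals_closure (\<Union> ?S) \<subseteq> ?V" by fastforce
      then show ?thesis
        by (simp add: less_eq_frame_of_reals.rep_eq inf_frame_of_reals.rep_eq
            Sup_frame_of_reals.rep_eq)
    qed
  qed
qed

text \<open>The generator \<open>(p,q)\<close>, as the least closed set containing the pair; the pairs \<open>(r,s)\<close>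
  with \<open>s \<le> r\<close> are bottom elements by (R3).\<close>

lift_definition rgen :: "rat \<Rightarrow> rat \<Rightarrow> frame_of_reals"
  is "\<lambda>p q. {(r, s). s \<le> r \<or> p \<le> r \<and> s \<le> q}"
proof (rule reals_idealI, goal_cases)
  case (3 p q p' q')
  have "p \<le> p' \<and> q' \<le> q" if *: "\<not> q' \<le> p'"
  proof -
    have "p \<le> p'"
    proof (rule ccontr)
      assume "\<not> p \<le> p'"
      then obtain r where r: "p' < r" "r < min p q'" using * dense[of p' "min p q'"] by auto
      moreover obtain s where "r < s" "s < q'" using dense[of r q'] r by auto
      ultimately show False using 3[of r s] by auto
    qed
    moreover have "q' \<le> q"
    proof (rule ccontr)
      assume "\<not> q' \<le> q"
      then obtain s where s: "max p' q < s" "s < q'" using * dense[of "max p' q" q'] by auto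
      moreover obtain r where "p' < r" "r < s" using dense[of p' s] s by auto
      ultimately show False using 3[of r s] by auto
    qed
    ultimately show ?thesis ..
  qed
  then show ?case by auto
qed auto

lemma rgen_le_iff: "rgen p q \<le> A \<longleftrightarrow> (p, q) \<in> Rep_frame_of_reals A"
proof transfer
  fix p q A assume A: "reals_ideal A"
  have "(r, s) \<in> A" if "s \<le> r" for r s using that by - (rule reals_idealD3[OF A], auto)
  then show "{(r, s). s \<le> r \<or> p \<le> r \<and> s \<le> q} \<subseteq> A \<longleftrightarrow> (p, q) \<in> A"
    by (auto intro: reals_idealD1[OF A])
qed

lemma rgen_mono: "p \<le> r \<Longrightarrow> s \<le> q \<Longrightarrow> rgen r s \<le> rgen p q"
  by transfer auto

lemma rgen_generate: "A = Sup {rgen p q | p q. rgen p q \<le> A}"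
proof (rule antisym)
  have "Rep_frame_of_reals A \<subseteq> Rep_frame_of_reals (Sup {rgen p q | p q. rgen p q \<le> A})"
  proof clarify
    fix p q assume "(p, q) \<in> Rep_frame_of_reals A"
    then have "rgen p q \<le> A" by (simp add: rgen_le_iff)
    then have "rgen p q \<le> Sup {rgen p q | p q. rgen p q \<le> A}" by (blast intro: Sup_upper)
    then show "(p, q) \<in> Rep_frame_of_reals (Sup {rgen p q | p q. rgen p q \<le> A})"
      by (simp add: rgen_le_iff)
  qed
  then show "A \<le> Sup {rgen p q | p q. rgen p q \<le> A}" by (simp add: less_eq_frame_of_reals.rep_eq)
qed (auto intro: Sup_least)

theorem real_relations_rgen: "real_relations rgen"
  unfolding real_relations_def
proof (intro conjI allI impI)
  fix p q r s
  show "inf (rgen p q) (rgen r s) = rgen (max p r) (min q s)"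
    by transfer auto
next
  fix p q r s :: rat assume *: "p \<le> r \<and> r < q \<and> q \<le> s"
  show "sup (rgen p q) (rgen r s) = rgen p s"
  proof (rule antisym)
    show "sup (rgen p q) (rgen r s) \<le> rgen p s" using * by (auto intro!: rgen_mono)
    have "rgen p q \<le> sup (rgen p q) (rgen r s)" "rgen r s \<le> sup (rgen p q) (rgen r s)" by auto
    then show "rgen p s \<le> sup (rgen p q) (rgen r s)"
      unfolding rgen_le_iff using * reals_idealD2[OF reals_ideal_Rep] by blast
  qed
next
  fix p q :: rat
  let ?S = "{rgen r s | r s. p < r \<and> r < s \<and> s < q}"
  show "rgen p q = Sup ?S"
  proof (rule antisym)
    show "Sup ?S \<le> rgen p q" by (auto intro!: Sup_least rgen_mono)
    have "rgen r s \<le> Sup ?S" if "p < r" "r < s" "s < q" for r s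
      using that by (blast intro: Sup_upper)
    then show "rgen p q \<le> Sup ?S"
      unfolding rgen_le_iff by - (rule reals_idealD3[OF reals_ideal_Rep], auto)
  qed
next
  show "top = Sup {rgen p q | p q. True}"
    using rgen_generate[of top] by simp
qed

text \<open>The extension to the whole frame of an assignment on generators.\<close>

definition hom_of :: "(rat \<Rightarrow> rat \<Rightarrow> 'a::frame) \<Rightarrow> frame_of_reals \<Rightarrow> 'a" where
  "hom_of f A = Sup {f p q | p q. rgen p q \<le> A}"

lemma frame_homD:
  assumes "frame_hom h"
  shows "h (Sup S) = Sup (h ` S)" "h (inf x y) = inf (h x) (h y)" "h top = top"
  using assms unfolding frame_hom_def by auto

lemma frame_hom_sup: "frame_hom h \<Longrightarrow> h (sup x y) = sup (h x) (h y)"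
  using frame_homD(1)[of h "{x, y}"] by simp

lemma frame_hom_mono: "frame_hom h \<Longrightarrow> x \<le> y \<Longrightarrow> h x \<le> h y"
  by (metis frame_homD(2) inf.absorb_iff2 inf_commute)

lemma Sup_inf_frame: "inf (Sup S) a = Sup ((\<lambda>s. inf s a) ` S)" for a :: "'a::frame"
  by (simp add: inf_commute[of _ a] inf_Sup_frame)

lemma
  assumes f: "real_relations f"
  shows real_relations1: "inf (f p q) (f r s) = f (max p r) (min q s)"
    and real_relations2: "p \<le> r \<Longrightarrow> r < q \<Longrightarrow> q \<le> s \<Longrightarrow> sup (f p q) (f r s) = f p s"
    and real_relations3: "f p q = Sup {f r s | r s. p < r \<and> r < s \<and> s < q}"
    and real_relations4: "Sup {f p q | p q. True} = top"
  using f unfolding real_relations_def by (blast, blast, blast, metis)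

lemma real_relations_mono:
  assumes f: "real_relations f" and "p \<le> r" "s \<le> q"
  shows "f r s \<le> f p q"
  using real_relations1[OF f, of p q r s] assms(2,3)
  by (metis inf.cobounded1 max.absorb2 min.absorb2)

lemma real_relations_empty:
  assumes f: "real_relations f" and "q \<le> p" shows "f p q = bot"
proof -
  have *: "{f r s | r s. p < r \<and> r < s \<and> s < q} = {}" using assms(2) by auto
  show ?thesis using real_relations3[OF f, of p q] unfolding * by simp
qed

lemma reals_ideal_below:
  assumes f: "real_relations f" shows "reals_ideal {(p, q). f p q \<le> b}"
proof (rule reals_idealI, goal_cases)
  case (1 p q r s) then show ?case using real_relations_mono[OF f, of p r s q] order_trans by auto
next
  case (2 p q r s) then show ?case using real_relations2[OF f, of p r q s] sup_least[of "f p q" b "f r s"] by auto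
next
  case (3 p q) 
  then have "Sup {f r s | r s. p < r \<and> r < s \<and> s < q} \<le> b" by (auto intro!: Sup_least)
  then show ?case using real_relations3[OF f, of p q] by simp
qed

lemma hom_of_rgen:
  assumes f: "real_relations f" shows "hom_of f (rgen p q) = f p q"
proof (rule antisym)
  show "f p q \<le> hom_of f (rgen p q)" unfolding hom_of_def by (auto intro!: Sup_upper)
  have "f r s \<le> f p q" if "s \<le> r \<or> p \<le> r \<and> s \<le> q" for r s
    using that real_relations_empty[OF f, of s r] real_relations_mono[OF f, of p r s q] by auto
  then show "hom_of f (rgen p q) \<le> f p q"
    unfolding hom_of_def rgen_le_iff rgen.rep_eq by (auto intro!: Sup_least)
qed

lemma frame_hom_hom_of:
  assumes f: "real_relations f" shows "frame_hom (hom_of f)"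
  unfolding frame_hom_def
proof (intro conjI allI)
  have mono: "hom_of f A \<le> hom_of f B" if "A \<le> B" for A B
    unfolding hom_of_def using that order_trans by (blast intro!: Sup_subset_mono)
  have upper: "f p q \<le> hom_of f A" if "rgen p q \<le> A" for p q A
    unfolding hom_of_def using that by (blast intro: Sup_upper)
  fix S
  show "hom_of f (Sup S) = Sup (hom_of f ` S)"
  proof (rule antisym)
    show "Sup (hom_of f ` S) \<le> hom_of f (Sup S)"
      by (auto intro!: Sup_least mono intro: Sup_upper)
    let ?U = "{(p, q). f p q \<le> Sup (hom_of f ` S)}"
    have "Rep_frame_of_reals (Sup S) \<subseteq> ?U"
      unfolding Sup_frame_of_reals.rep_eq
    proof (rule reals_closure_least[OF reals_ideal_below[OF f]])
      have "f p q \<le> Sup (hom_of f ` S)" if "A \<in> S" "(p, q) \<in> Rep_frame_of_reals A" for p q A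
        using upper[of p q A] that by (simp add: rgen_le_iff) (meson SUP_upper2)
      then show "\<Union> (Rep_frame_of_reals ` S) \<subseteq> ?U" by auto
    qed
    then show "hom_of f (Sup S) \<le> Sup (hom_of f ` S)"
      unfolding hom_of_def[of f "Sup S"] rgen_le_iff by (auto intro!: Sup_least)
  qed
  fix A B
  show "hom_of f (inf A B) = inf (hom_of f A) (hom_of f B)"
  proof (rule antisym)
    show "hom_of f (inf A B) \<le> inf (hom_of f A) (hom_of f B)" by (simp add: mono)
    have "inf (f p q) (f r s) \<le> hom_of f (inf A B)" if "rgen p q \<le> A" "rgen r s \<le> B" for p q r s
      unfolding real_relations1[OF f]
      using that by (intro upper) (metis inf_mono real_relations1[OF real_relations_rgen])
    then show "inf (hom_of f A) (hom_of f B) \<le> hom_of f (inf A B)"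
      unfolding hom_of_def[of f A] hom_of_def[of f B] Sup_inf_frame inf_Sup_frame
      by (auto intro!: Sup_least simp: inf_Sup_frame)
  qed
next
  show "hom_of f top = top" using real_relations4[OF f] by (simp add: hom_of_def)
qed

theorem frame_of_reals_universal:
  assumes f: "real_relations f"
  shows "\<exists>!h. frame_hom h \<and> (\<forall>p q. h (rgen p q) = f p q)"
proof (rule ex1I)
  show "frame_hom (hom_of f) \<and> (\<forall>p q. hom_of f (rgen p q) = f p q)"
    using frame_hom_hom_of[OF f] hom_of_rgen[OF f] by blast
  fix h assume h: "frame_hom h \<and> (\<forall>p q. h (rgen p q) = f p q)"
  show "h = hom_of f"
  proof
    fix A
    have "h A = h (Sup {rgen p q | p q. rgen p q \<le> A})"
      by (rule arg_cong[OF rgen_generate])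
    also have "\<dots> = Sup (h ` {rgen p q | p q. rgen p q \<le> A})"
      using h by (intro frame_homD(1)) blast
    also have "h ` {rgen p q | p q. rgen p q \<le> A} = {h (rgen p q) | p q. rgen p q \<le> A}" by blast
    also have "\<dots> = {f p q | p q. rgen p q \<le> A}" using h by simp
    finally show "h A = hom_of f A" unfolding hom_of_def .
  qed
qed

lemma real_relations_frame_hom:
  assumes h: "frame_hom h" shows "real_relations (\<lambda>p q. h (rgen p q))"
  unfolding real_relations_def
proof (intro conjI allI impI)
  note g = real_relations_rgen
  fix p q r s
  show "inf (h (rgen p q)) (h (rgen r s)) = h (rgen (max p r) (min q s))"
    using frame_homD(2)[OF h] real_relations1[OF g] by metis
  show "p \<le> r \<and> r < q \<and> q \<le> s \<Longrightarrow> sup (h (rgen p q)) (h (rgen r s)) = h (rgen p s)"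
    using frame_hom_sup[OF h] real_relations2[OF g] by metis
  have "h (rgen p q) = h (Sup {rgen r s | r s. p < r \<and> r < s \<and> s < q})"
    by (rule arg_cong[OF real_relations3[OF g]])
  also have "\<dots> = Sup (h ` {rgen r s | r s. p < r \<and> r < s \<and> s < q})"
    by (rule frame_homD(1)[OF h])
  also have "h ` {rgen r s | r s. p < r \<and> r < s \<and> s < q} =
      {h (rgen r s) | r s. p < r \<and> r < s \<and> s < q}" by blast
  finally show "h (rgen p q) = Sup {h (rgen r s) | r s. p < r \<and> r < s \<and> s < q}" .
next
  have "top = h (Sup {rgen p q | p q. True})"
    using frame_homD(3)[OF h] real_relations4[OF real_relations_rgen] by simp
  also have "\<dots> = Sup (h ` {rgen p q | p q. True})" by (rule frame_homD(1)[OF h])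
  also have "h ` {rgen p q | p q. True} = {h (rgen p q) | p q. True}" by blast
  finally show "top = Sup {h (rgen p q) | p q. True}" .
qed

section \<open>The ring of real-valued continuous functions on a frame\<close>

definition Rfun :: "(frame_of_reals \<Rightarrow> 'a::frame) set" where
  "Rfun = {\<alpha>. frame_hom \<alpha>}"

definition rat_interval :: "rat \<Rightarrow> rat \<Rightarrow> real set" where
  "rat_interval p q = {t. of_rat p < t \<and> t < of_rat q}"

definition pointwise ::
    "(real \<Rightarrow> real \<Rightarrow> real) \<Rightarrow> (frame_of_reals \<Rightarrow> 'a::frame) \<Rightarrow> (frame_of_reals \<Rightarrow> 'a) \<Rightarrow>
      frame_of_reals \<Rightarrow> 'a" where
  "pointwise d \<alpha> \<beta> = hom_of (\<lambda>p q. Sup {inf (\<alpha> (rgen r s)) (\<beta> (rgen u v)) | r s u v.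
     {d x y | x y. x \<in> rat_interval r s \<and> y \<in> rat_interval u v} \<subseteq> rat_interval p q})"

definition Rplus :: "(frame_of_reals \<Rightarrow> 'a::frame) \<Rightarrow> (frame_of_reals \<Rightarrow> 'a) \<Rightarrow> frame_of_reals \<Rightarrow> 'a"
  where "Rplus = pointwise (+)"

definition Rconst :: "real \<Rightarrow> frame_of_reals \<Rightarrow> 'a::frame" where
  "Rconst r = hom_of (\<lambda>p q. if of_rat p < r \<and> r < of_rat q then top else bot)"

text \<open>The additive inverse; see \<open>Rplus_Runeg\<close> below.\<close>

definition Runeg :: "(frame_of_reals \<Rightarrow> 'a::frame) \<Rightarrow> frame_of_reals \<Rightarrow> 'a" where
  "Runeg \<alpha> = hom_of (\<lambda>p q. \<alpha> (rgen (- q) (- p)))"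

definition Rminus :: "(frame_of_reals \<Rightarrow> 'a::frame) \<Rightarrow> (frame_of_reals \<Rightarrow> 'a) \<Rightarrow> frame_of_reals \<Rightarrow> 'a"
  where "Rminus \<alpha> \<beta> = Rplus \<alpha> (Runeg \<beta>)"

text \<open>These assignments on generators respect the relations, so that the functions above are the
  homomorphisms with the given values on generators, and \<open>Runeg\<close> yields additive inverses.\<close>

lemma frame_inf_Sup_le:
  fixes c :: "'a::frame"
  assumes "\<And>a b. a \<in> A \<Longrightarrow> b \<in> B \<Longrightarrow> inf a b \<le> c"
  shows "inf (Sup A) (Sup B) \<le> c"
  unfolding Sup_inf_frame inf_Sup_frame using assms by (auto intro!: Sup_least)

lemma real_relationsI:
  assumes mono: "\<And>p q r s. p \<le> r \<Longrightarrow> s \<le> q \<Longrightarrow> f r s \<le> f p q"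
    and "\<And>p q r s. inf (f p q) (f r s) \<le> f (max p r) (min q s)"
    and "\<And>p q r s. p \<le> r \<Longrightarrow> r < q \<Longrightarrow> q \<le> s \<Longrightarrow> f p s \<le> sup (f p q) (f r s)"
    and "\<And>p q. f p q \<le> Sup {f r s | r s. p < r \<and> r < s \<and> s < q}"
    and "top \<le> Sup {f p q | p q. True}"
  shows "real_relations f"
  unfolding real_relations_def
proof (intro conjI allI impI)
  show "inf (f p q) (f r s) = f (max p r) (min q s)" for p q r s
    by (intro antisym assms(2) le_infI mono) auto
  show "sup (f p q) (f r s) = f p s" if "p \<le> r \<and> r < q \<and> q \<le> s" for p q r s
    using that by (intro antisym assms(3) le_supI mono) auto
  show "f p q = Sup {f r s | r s. p < r \<and> r < s \<and> s < q}" for p q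
  proof (intro antisym assms(4) Sup_least)
    fix x assume "x \<in> {f r s | r s. p < r \<and> r < s \<and> s < q}"
    then obtain r s where "x = f r s" "p < r" "s < q" by blast
    then show "x \<le> f p q" by (simp add: mono)
  qed
  show "top = Sup {f p q | p q. True}" by (intro antisym assms(5)) simp
qed

lemma real_relations_const:
  fixes r :: real
  shows "real_relations (\<lambda>p q. if of_rat p < r \<and> r < of_rat q then top else bot :: 'a::frame)"
    (is "real_relations ?f")
proof (rule real_relationsI)
  have refine: "\<exists>u v. p < u \<and> u < v \<and> v < q \<and> of_rat u < r \<and> r < of_rat v"
    if "of_rat p < r" "r < of_rat q" for p q
  proof -
    note r = that
    obtain u where u: "of_rat p < (of_rat u :: real)" "of_rat u < r"
      using of_rat_dense[OF r(1)] by blast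
    obtain v where v: "r < of_rat v" "of_rat v < (of_rat q :: real)"
      using of_rat_dense[OF r(2)] by blast
    have "(of_rat u :: real) < of_rat v" using u v by linarith
    with u v show ?thesis by (auto simp: of_rat_less)
  qed
  fix p q t s :: rat
  show "?f t s \<le> ?f p q" if "p \<le> t" "s \<le> q"
    using that by (auto simp: of_rat_less_eq[where 'a = real, symmetric])
  show "inf (?f p q) (?f t s) \<le> ?f (max p t) (min q s)" by (auto simp: max_def min_def)
  show "?f p s \<le> sup (?f p q) (?f t s)" if "p \<le> t" "t < q" "q \<le> s"
    using that by (auto simp: of_rat_less[where 'a = real, symmetric])
  show "?f p q \<le> Sup {?f u v | u v. p < u \<and> u < v \<and> v < q}"
  proof (cases "of_rat p < r \<and> r < of_rat q")
    case True
    then obtain u v where "p < u" "u < v" "v < q" "of_rat u < r" "r < of_rat v"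
      using refine by blast
    then show ?thesis by (intro Sup_upper2[of "?f u v"]) auto
  qed auto
next
  obtain p q where "of_rat p < r" "r < of_rat q"
    using of_rat_dense[of "r - 1" r] of_rat_dense[of r "r + 1"] by auto
  then show "top \<le> Sup {?f p q | p q. True}" by (intro Sup_upper2[of "?f p q"]) auto
qed

lemma Rconst_in_Rfun: "Rconst r \<in> Rfun"
  unfolding Rconst_def Rfun_def using frame_hom_hom_of[OF real_relations_const] by simp

lemma Rconst_rgen:
  "Rconst r (rgen p q) = (if of_rat p < r \<and> r < of_rat q then top else bot)"
  unfolding Rconst_def by (rule hom_of_rgen[OF real_relations_const])

lemma real_relations_uminus:
  assumes f: "real_relations f" shows "real_relations (\<lambda>p q. f (- q) (- p))"
proof (rule real_relationsI)
  fix p q r s :: rat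
  show "f (- s) (- r) \<le> f (- q) (- p)" if "p \<le> r" "s \<le> q"
    using that by (intro real_relations_mono[OF f]) auto
  show "inf (f (- q) (- p)) (f (- s) (- r)) \<le> f (- min q s) (- max p r)"
    by (simp add: real_relations1[OF f] minus_max_eq_min minus_min_eq_max)
  show "f (- s) (- p) \<le> sup (f (- q) (- p)) (f (- s) (- r))" if "p \<le> r" "r < q" "q \<le> s"
    using real_relations2[OF f, of "- s" "- q" "- r" "- p"] that by (simp add: sup_commute)
  have "f (- q) (- p) = Sup {f u v | u v. - q < u \<and> u < v \<and> v < - p}"
    by (rule real_relations3[OF f])
  also have "\<dots> \<le> Sup {f (- s) (- r) | r s. p < r \<and> r < s \<and> s < q}"
  proof (rule Sup_subset_mono, clarify)
    fix u v assume "- q < u" "u < v" "v < - p"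
    then show "\<exists>r s. f u v = f (- s) (- r) \<and> p < r \<and> r < s \<and> s < q"
      by (intro exI[of _ "- v"] exI[of _ "- u"]) auto
  qed
  finally show "f (- q) (- p) \<le> Sup {f (- s) (- r) | r s. p < r \<and> r < s \<and> s < q}" .
next
  have "Sup {f p q | p q. True} \<le> Sup {f (- q) (- p) | p q. True}"
  proof (rule Sup_subset_mono, clarify)
    fix u v
    show "\<exists>p q. f u v = f (- q) (- p) \<and> True"
      by (intro exI[of _ "- v"] exI[of _ "- u"]) auto
  qed
  then show "top \<le> Sup {f (- q) (- p) | p q. True}" unfolding real_relations4[OF f] .
qed

lemma
  assumes "\<alpha> \<in> Rfun"
  shows Runeg_in_Rfun: "Runeg \<alpha> \<in> Rfun"
    and Runeg_rgen: "Runeg \<alpha> (rgen p q) = \<alpha> (rgen (- q) (- p))"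
proof -
  have *: "real_relations (\<lambda>p q. \<alpha> (rgen (- q) (- p)))"
    using assms real_relations_uminus[OF real_relations_frame_hom] unfolding Rfun_def by auto
  show "Runeg \<alpha> \<in> Rfun" "Runeg \<alpha> (rgen p q) = \<alpha> (rgen (- q) (- p))"
    unfolding Runeg_def Rfun_def using frame_hom_hom_of[OF *] hom_of_rgen[OF *] by auto
qed

lemma real_relations_small:
  assumes f: "real_relations f" and e: "0 < e"
  shows "f p q \<le> Sup {f r s | r s. p \<le> r \<and> r < s \<and> s \<le> q \<and> s - r < e}" (is "_ \<le> ?J")
proof -
  define d where "d = e / 3"
  have d: "0 < d" "2 * d < e" using e by (auto simp: d_def)
  have small: "f r s \<le> ?J" if "p \<le> r" "s \<le> q" "s - r < e" for r s
  proof (cases "r < s")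
    case True
    with that show ?thesis by (blast intro: Sup_upper)
  next
    case False
    then show ?thesis by (simp add: real_relations_empty[OF f])
  qed
  have "f p s \<le> ?J" if "s \<le> q" "s - p \<le> of_nat n * d" for n s
    using that
  proof (induction n arbitrary: s)
    case 0
    then show ?case by (simp add: real_relations_empty[OF f])
  next
    case (Suc n)
    show ?case
    proof (cases "s - p < e")
      case True
      then show ?thesis using small Suc.prems by blast
    next
      case False
      have 1: "f p (s - d) \<le> ?J" using Suc.prems d by (intro Suc.IH) (auto simp: algebra_simps)
      have 2: "f (s - 2 * d) s \<le> ?J" using False Suc.prems d by (intro small) auto
      have "sup (f p (s - d)) (f (s - 2 * d) s) = f p s"
        using False d by (intro real_relations2[OF f]) auto
      with le_supI[OF 1 2] show ?thesis by simp
    qed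
  qed
  moreover obtain n where "(q - p) / d \<le> of_nat n" using real_arch_simple[of "(q - p) / d"] by blast
  ultimately show ?thesis using d by (auto simp: field_simps)
qed

lemma rat_interval_plus_subset_iff:
  assumes "r < s" "u < v"
  shows "{x + y | x y. x \<in> rat_interval r s \<and> y \<in> rat_interval u v} \<subseteq> rat_interval p q \<longleftrightarrow>
    p \<le> r + u \<and> s + v \<le> q" (is "?S \<subseteq> _ \<longleftrightarrow> _")
proof
  assume sub: "?S \<subseteq> rat_interval p q"
  have mem: "p < x + y \<and> x + y < q" if "r < x" "x < s" "u < y" "y < v" for x y
  proof -
    have "of_rat x + of_rat y \<in> ?S"
      using that
      by (intro CollectI exI[of _ "of_rat x"] exI[of _ "of_rat y"])
        (simp add: rat_interval_def of_rat_less)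
    with sub have "of_rat (x + y) \<in> rat_interval p q" by (auto simp: of_rat_add)
    then show ?thesis by (auto simp: rat_interval_def of_rat_less)
  qed
  show "p \<le> r + u \<and> s + v \<le> q"
  proof (intro conjI; rule ccontr)
    assume "\<not> p \<le> r + u"
    define e where "e = min (min ((s - r) / 2) ((v - u) / 2)) ((p - (r + u)) / 2)"
    have "0 < e" "e \<le> (s - r) / 2" "e \<le> (v - u) / 2" "e \<le> (p - (r + u)) / 2"
      using assms \<open>\<not> p \<le> r + u\<close> 
      by (auto simp: e_def simp del: le_divide_eq_numeral1 intro: min.coboundedI1 min.coboundedI2)
    moreover from this have "p < (r + e) + (u + e)"
      using assms by (intro mem[THEN conjunct1]) (auto simp: field_simps)
    ultimately show False by (auto simp: field_simps)
  next
    assume "\<not> s + v \<le> q"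
    define e where "e = min (min ((s - r) / 2) ((v - u) / 2)) ((s + v - q) / 2)"
    have "0 < e" "e \<le> (s - r) / 2" "e \<le> (v - u) / 2" "e \<le> (s + v - q) / 2"
      using assms \<open>\<not> s + v \<le> q\<close> 
      by (auto simp: e_def simp del: le_divide_eq_numeral1 intro: min.coboundedI1 min.coboundedI2)
    moreover from this have "(s - e) + (v - e) < q"
      using assms by (intro mem[THEN conjunct2]) (auto simp: field_simps)
    ultimately show False by (auto simp: field_simps)
  qed
next
  assume pq: "p \<le> r + u \<and> s + v \<le> q"
  then have "(of_rat p :: real) \<le> of_rat r + of_rat u" "(of_rat s + of_rat v :: real) \<le> of_rat q"
    by (auto simp: of_rat_less_eq simp flip: of_rat_add)
  then show "?S \<subseteq> rat_interval p q" by (auto simp: rat_interval_def)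
qed

lemma Sup_plus_eq:
  assumes f: "real_relations f" and g: "real_relations g"
  shows "Sup {inf (f r s) (g u v) | r s u v.
      {x + y | x y. x \<in> rat_interval r s \<and> y \<in> rat_interval u v} \<subseteq> rat_interval p q} =
    Sup {inf (f r s) (g u v) | r s u v. r < s \<and> u < v \<and> p \<le> r + u \<and> s + v \<le> q}"
    (is "?L = Sup ?R")
proof (rule antisym)
  show "?L \<le> Sup ?R"
  proof (rule Sup_least, clarify)
    fix r s u v
    assume sub: "{x + y | x y. x \<in> rat_interval r s \<and> y \<in> rat_interval u v} \<subseteq> rat_interval p q"
    show "inf (f r s) (g u v) \<le> Sup ?R"
    proof (cases "r < s \<and> u < v")
      case True
      then have "p \<le> r + u \<and> s + v \<le> q" using sub by (simp only: rat_interval_plus_subset_iff)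
      with True show ?thesis by (intro Sup_upper) blast
    next
      case False
      then show ?thesis by (auto simp: real_relations_empty[OF f] real_relations_empty[OF g])
    qed
  qed
  show "Sup ?R \<le> ?L"
  proof (rule Sup_subset_mono, rule subsetI)
    fix x assume "x \<in> ?R"
    then obtain r s u v where "x = inf (f r s) (g u v)" "r < s" "u < v" "p \<le> r + u \<and> s + v \<le> q"
      by blast
    then show "x \<in> {inf (f r s) (g u v) | r s u v.
        {x + y | x y. x \<in> rat_interval r s \<and> y \<in> rat_interval u v} \<subseteq> rat_interval p q}"
      by (intro CollectI exI[of _ r] exI[of _ s] exI[of _ u] exI[of _ v])
        (simp only: rat_interval_plus_subset_iff)
  qed
qed

lemma real_relations_plus:
  assumes f: "real_relations f" and g: "real_relations g"
  shows "real_relations (\<lambda>p q.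
    Sup {inf (f r s) (g u v) | r s u v. r < s \<and> u < v \<and> p \<le> r + u \<and> s + v \<le> q})"
    (is "real_relations ?h")
proof (rule real_relationsI)
  have upper: "inf (f r s) (g u v) \<le> ?h p q" if "p \<le> r + u" "s + v \<le> q" for p q r s u v
  proof (cases "r < s \<and> u < v")
    case True
    then show ?thesis using that by (intro Sup_upper) blast
  next
    case False
    then show ?thesis by (auto simp: real_relations_empty[OF f] real_relations_empty[OF g])
  qed
  show "?h r s \<le> ?h p q" if "p \<le> r" "s \<le> q" for p q r s
    by (rule Sup_least, clarify, rule upper) (use that in linarith)+
  show "inf (?h p q) (?h p' q') \<le> ?h (max p p') (min q q')" for p q p' q'
  proof (rule frame_inf_Sup_le, clarify)
    fix r s u v r' s' u' v'
    assume *: "p \<le> r + u" "s + v \<le> q" "p' \<le> r' + u'" "s' + v' \<le> q'"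
    have "inf (inf (f r s) (g u v)) (inf (f r' s') (g u' v')) =
        inf (inf (f r s) (f r' s')) (inf (g u v) (g u' v'))"
      by (simp add: inf_assoc inf_left_commute)
    also have "\<dots> = inf (f (max r r') (min s s')) (g (max u u') (min v v'))"
      by (simp add: real_relations1[OF f] real_relations1[OF g])
    also have "\<dots> \<le> ?h (max p p') (min q q')"
      by (rule upper) (use * in \<open>auto simp: max_def min_def\<close>)
    finally show "inf (inf (f r s) (g u v)) (inf (f r' s') (g u' v')) \<le> ?h (max p p') (min q q')" .
  qed
  show "?h p s \<le> sup (?h p q) (?h r s)" if *: "p \<le> r" "r < q" "q \<le> s" for p q r s
  proof (rule Sup_least, clarify)
    fix a b c d assume ab: "p \<le> a + c" "b + d \<le> s"
    define e where "e = (q - r) / 2"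
    have e: "0 < e" using * by (simp add: e_def)
    have "inf (f a b) (g c d) \<le>
        inf (Sup {f x y | x y. a \<le> x \<and> x < y \<and> y \<le> b \<and> y - x < e})
          (Sup {g x y | x y. c \<le> x \<and> x < y \<and> y \<le> d \<and> y - x < e})"
      by (intro inf_mono real_relations_small f g e)
    also have "\<dots> \<le> sup (?h p q) (?h r s)"
    proof (rule frame_inf_Sup_le, clarify)
      fix x y z w
      assume xy: "a \<le> x" "y \<le> b" "y - x < e" "c \<le> z" "w \<le> d" "w - z < e"
      show "inf (f x y) (g z w) \<le> sup (?h p q) (?h r s)"
      proof (cases "y + w \<le> q")
        case True
        then show ?thesis by (intro le_supI1 upper) (use xy ab in auto)
      next
        case False
        have "r \<le> x + z" using False xy by (simp add: e_def field_simps)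
        then show ?thesis by (intro le_supI2 upper) (use xy ab in auto)
      qed
    qed
    finally show "inf (f a b) (g c d) \<le> sup (?h p q) (?h r s)" .
  qed
  show "?h p q \<le> Sup {?h r s | r s. p < r \<and> r < s \<and> s < q}" (is "_ \<le> Sup ?H") for p q
  proof (rule Sup_least, clarify)
    fix a b c d assume ab: "p \<le> a + c" "b + d \<le> q"
    have "inf (f a b) (g c d) = inf (Sup {f x y | x y. a < x \<and> x < y \<and> y < b})
          (Sup {g x y | x y. c < x \<and> x < y \<and> y < d})"
      by (intro arg_cong2[where f = inf] real_relations3 f g)
    also have "\<dots> \<le> Sup ?H"
    proof (rule frame_inf_Sup_le, clarify)
      fix x y z w
      assume xy: "a < x" "x < y" "y < b" "c < z" "z < w" "w < d"
      have "inf (f x y) (g z w) \<le> ?h (x + z) (y + w)" by (rule upper) auto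
      moreover have "?h (x + z) (y + w) \<in> ?H" using xy ab by (intro CollectI exI conjI) (rule refl, auto)
      ultimately show "inf (f x y) (g z w) \<le> Sup ?H" by (rule Sup_upper2[rotated])
    qed
    finally show "inf (f a b) (g c d) \<le> Sup ?H" .
  qed
  have "top = inf (Sup {f p q | p q. True}) (Sup {g p q | p q. True})"
    unfolding real_relations4[OF f] real_relations4[OF g] by simp
  also have "\<dots> \<le> Sup {?h p q | p q. True}"
  proof (rule frame_inf_Sup_le, clarify)
    fix r s u v
    have "inf (f r s) (g u v) \<le> ?h (r + u) (s + v)" by (rule upper) auto
    then show "inf (f r s) (g u v) \<le> Sup {?h p q | p q. True}"
      by (rule Sup_upper2[rotated]) blast
  qed
  finally show "top \<le> Sup {?h p q | p q. True}" .
qed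

lemma
  assumes "\<alpha> \<in> Rfun" "\<beta> \<in> Rfun"
  shows Rplus_in_Rfun: "Rplus \<alpha> \<beta> \<in> Rfun"
    and Rplus_rgen: "Rplus \<alpha> \<beta> (rgen p q) =
      Sup {inf (\<alpha> (rgen r s)) (\<beta> (rgen u v)) | r s u v.
        r < s \<and> u < v \<and> p \<le> r + u \<and> s + v \<le> q}"
proof -
  have \<alpha>: "real_relations (\<lambda>p q. \<alpha> (rgen p q))" and \<beta>: "real_relations (\<lambda>p q. \<beta> (rgen p q))"
    using assms real_relations_frame_hom unfolding Rfun_def by auto
  show "Rplus \<alpha> \<beta> \<in> Rfun"
    unfolding Rplus_def pointwise_def Sup_plus_eq[OF \<alpha> \<beta>] Rfun_def
    using frame_hom_hom_of[OF real_relations_plus[OF \<alpha> \<beta>]] by simp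
  show "Rplus \<alpha> \<beta> (rgen p q) = Sup {inf (\<alpha> (rgen r s)) (\<beta> (rgen u v)) | r s u v.
        r < s \<and> u < v \<and> p \<le> r + u \<and> s + v \<le> q}"
    unfolding Rplus_def pointwise_def Sup_plus_eq[OF \<alpha> \<beta>]
    by (rule hom_of_rgen[OF real_relations_plus[OF \<alpha> \<beta>]])
qed

lemma Rfun_eqI:
  assumes "\<alpha> \<in> Rfun" "\<beta> \<in> Rfun" "\<And>p q. \<alpha> (rgen p q) = \<beta> (rgen p q)"
  shows "\<alpha> = \<beta>"
  using frame_of_reals_universal[OF real_relations_frame_hom, of \<beta>] assms
  unfolding Rfun_def by blast

lemma Rplus_Runeg:
  assumes "\<alpha> \<in> Rfun" shows "Rplus \<alpha> (Runeg \<alpha>) = Rconst 0"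
proof (rule Rfun_eqI)
  show "Rplus \<alpha> (Runeg \<alpha>) \<in> Rfun" by (intro Rplus_in_Rfun Runeg_in_Rfun assms)
  show "Rconst 0 \<in> Rfun" by (rule Rconst_in_Rfun)
  have \<alpha>: "real_relations (\<lambda>p q. \<alpha> (rgen p q))"
    using assms real_relations_frame_hom unfolding Rfun_def by auto
  fix p q
  let ?R = "{inf (\<alpha> (rgen r s)) (\<alpha> (rgen (- v) (- u))) | r s u v.
        r < s \<and> u < v \<and> p \<le> r + u \<and> s + v \<le> q}"
  have "Sup ?R = (if p < 0 \<and> 0 < q then top else bot)"
  proof (cases "p < 0 \<and> 0 < q")
    case True
    have small: "\<alpha> (rgen r s) \<le> Sup ?R" if "r < s" "s - r < min (- p) q" for r s
    proof (rule Sup_upper)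
      show "\<alpha> (rgen r s) \<in> ?R"
        using that by (intro CollectI exI[of _ r] exI[of _ s] exI[of _ "- s"] exI[of _ "- r"]) auto
    qed
    have "\<alpha> (rgen r s) \<le> Sup ?R" for r s
    proof -
      have "\<alpha> (rgen r s) \<le>
          Sup {\<alpha> (rgen x y) | x y. r \<le> x \<and> x < y \<and> y \<le> s \<and> y - x < min (- p) q}"
        by (rule real_relations_small[OF \<alpha>]) (use True in auto)
      also have "\<dots> \<le> Sup ?R" by (rule Sup_least, clarify, rule small)
      finally show ?thesis .
    qed
    then have "Sup {\<alpha> (rgen r s) | r s. True} \<le> Sup ?R" by (intro Sup_least) blast
    then have "top \<le> Sup ?R" unfolding real_relations4[OF \<alpha>] .
    with True show ?thesis by (simp add: top_le)
  next
    case False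
    have "inf (\<alpha> (rgen r s)) (\<alpha> (rgen (- v) (- u))) = bot" if "p \<le> r + u" "s + v \<le> q" "r < s" "u < v" for r s u v
    proof -
      have "min s (- u) \<le> max r (- v)" using that False by (auto simp: min_def max_def)
      then show ?thesis by (simp add: real_relations1[OF \<alpha>] real_relations_empty[OF \<alpha>])
    qed
    then have "Sup ?R \<le> bot" by (intro Sup_least) auto
    then show ?thesis unfolding if_not_P[OF False] by (rule le_bot)
  qed
  then show "Rplus \<alpha> (Runeg \<alpha>) (rgen p q) = Rconst 0 (rgen p q)"
    unfolding Rplus_rgen[OF assms Runeg_in_Rfun[OF assms]] Runeg_rgen[OF assms] Rconst_rgen
    by simp
qed

definition reals_above :: "rat \<Rightarrow> frame_of_reals" where
  "reals_above p = Sup {rgen r s | r s. r > p \<and> s > p}"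

definition reals_below :: "rat \<Rightarrow> frame_of_reals" where
  "reals_below q = Sup {rgen r s | r s. r < q \<and> s < q}"

definition coz :: "(frame_of_reals \<Rightarrow> 'a::frame) \<Rightarrow> 'a" where
  "coz \<alpha> = sup (\<alpha> (reals_below 0)) (\<alpha> (reals_above 0))"

definition completely_regular :: "'a::frame itself \<Rightarrow> bool" where
  "completely_regular _ \<longleftrightarrow> (\<forall>a::'a. \<exists>F \<subseteq> Rfun. a = Sup (coz ` F))"

definition Rset :: "(frame_of_reals \<Rightarrow> 'a::frame) \<Rightarrow> real set" where
  "Rset \<alpha> = {r. coz (Rminus \<alpha> (Rconst r)) \<noteq> top}"

definition Cc :: "(frame_of_reals \<Rightarrow> 'a::frame) set" where
  "Cc = {\<alpha> \<in> Rfun. countable (Rset \<alpha>)}"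

definition Coz_c :: "'a::frame set" where
  "Coz_c = coz ` Cc"

section \<open>Sigma-frames\<close>

definition subposet :: "'a::order set \<Rightarrow> 'a gorder" where
  "subposet A = \<lparr>carrier = A, eq = (=), le = (\<le>)\<rparr>"

text \<open>The bottom is the join of the empty set; a top is needed for the relation \<open>rather_below\<close>.
  All joins and meets below are formed in the poset \<open>L\<close> itself.\<close>

locale sigma_frame = bounded_lattice +
  assumes meet_join_distrib:
      "\<lbrakk>x \<in> carrier L; y \<in> carrier L; z \<in> carrier L\<rbrakk> \<Longrightarrow> x \<sqinter> (y \<squnion> z) = (x \<sqinter> y) \<squnion> (x \<sqinter> z)"
    and countable_join_exists:
      "\<lbrakk>S \<subseteq> carrier L; countable S\<rbrakk> \<Longrightarrow> \<exists>s. least L s (Upper L S)"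
    and meet_countable_join_distrib:
      "\<lbrakk>a \<in> carrier L; S \<subseteq> carrier L; countable S\<rbrakk> \<Longrightarrow> a \<sqinter> (\<Squnion>S) = \<Squnion>((\<lambda>s. a \<sqinter> s) ` S)"

definition rather_below :: "('a, 'b) gorder_scheme \<Rightarrow> 'a \<Rightarrow> 'a \<Rightarrow> bool" where
  "rather_below L a b \<longleftrightarrow>
     (\<exists>x \<in> carrier L. a \<sqinter>\<^bsub>L\<^esub> x = \<bottom>\<^bsub>L\<^esub> \<and> x \<squnion>\<^bsub>L\<^esub> b = \<top>\<^bsub>L\<^esub>)"

locale regular_sigma_frame = sigma_frame +
  assumes regular:
    "a \<in> carrier L \<Longrightarrow>
       \<exists>s :: nat \<Rightarrow> 'a. (\<forall>n. s n \<in> carrier L \<and> rather_below L (s n) a) \<and> a = \<Squnion>(range s)"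

end

theory Submission
  imports Defs "HOL-Analysis.Continuum_Not_Denumerable"
begin

text \<open>If the real \<open>r\<close> is not in \<open>Rset \<alpha>\<close>, then the disjoint elements \<open>\<alpha>(-,r)\<close> and \<open>\<alpha>(r,-)\<close>
  cover \<open>\<top>\<close>, so both are complemented. A countable \<open>Rset \<alpha>\<close> misses numbers arbitrarily close to
  \<open>0\<close> on either side, hence \<open>coz \<alpha>\<close> is a countable join of complemented elements. Conversely, let
  \<open>a\<close> be the join of an increasing sequence \<open>\<bottom> = d\<^sub>0 \<le> d\<^sub>1 \<le> \<dots>\<close> of complemented elements; the function
  with value \<open>1/n\<close> on \<open>d\<^sub>n \<setminus> d\<^sub>n\<^sub>-\<^sub>1\<close> and \<open>0\<close> elsewhere has countable range and cozero element
  \<open>a\<close>. So \<open>Coz_c\<close> consists of the countable joins of complemented elements. It contains the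
  complements of these elements, and \<open>c \<le> a\<close> implies \<open>c \<prec> a\<close> for complemented \<open>c\<close>.\<close>

section \<open>Complemented elements\<close>

\<comment> \<open>The frame law for the two-element set \<open>{y, z}\<close> is one distributive
  law; the class asks for its dual.\<close>
subclass (in frame) distrib_lattice
proof
  have "inf x (sup y z) = sup (inf x y) (inf x z)" for x y z
    using inf_Sup_frame[of x "{y, z}"] by simp
  then show "sup x (inf y z) = inf (sup x y) (sup x z)" for x y z
    by (rule distrib_imp1)
qed

definition complements :: "'a::frame \<Rightarrow> 'a \<Rightarrow> bool" where
  "complements c d \<longleftrightarrow> inf c d = bot \<and> sup c d = top"

definition complemented :: "'a::frame \<Rightarrow> bool" where
  "complemented c \<longleftrightarrow> (\<exists>d. complements c d)"

lemma complements_sym: "complements c d \<Longrightarrow> complements d c"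
  by (simp add: complements_def inf_commute sup_commute)

lemma complements_sup_top: "complements c d \<Longrightarrow> c \<le> x \<Longrightarrow> d \<le> y \<Longrightarrow> sup x y = top"
  using sup_mono[of c x d y] by (simp only: complements_def top_unique)

lemma complements_bot_top: "complements bot top"
  by (simp add: complements_def)

text \<open>De Morgan: distributivity puts \<open>c\<close> against \<open>c'\<close> in one part
  and \<open>d\<close> against \<open>d'\<close> in the other. With the roles of elements and
  complements exchanged, it also settles joins.\<close>

lemma complements_inf_sup:
  assumes "complements c c'" "complements d d'"
  shows "complements (inf c d) (sup c' d')"
proof -
  have "inf (inf c d) (sup c' d') = sup (inf d (inf c c')) (inf c (inf d d'))"
    by (simp add: inf_sup_distrib1 inf_assoc inf_left_commute)
  moreover have "sup (inf c d) (sup c' d') = inf (sup d' (sup c c')) (sup c' (sup d d'))"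
    unfolding sup_inf_distrib2 by (simp add: ac_simps)
  ultimately show ?thesis using assms by (simp add: complements_def)
qed

lemma complemented_bot: "complemented bot" and complemented_top: "complemented top"
  using complements_bot_top complements_sym[OF complements_bot_top] by (auto simp: complemented_def)

lemma complemented_inf: "complemented c \<Longrightarrow> complemented d \<Longrightarrow> complemented (inf c d)"
  unfolding complemented_def using complements_inf_sup by blast

lemma complemented_sup: "complemented c \<Longrightarrow> complemented d \<Longrightarrow> complemented (sup c d)"
  unfolding complemented_def using complements_inf_sup complements_sym by blast

lemma complemented_SUP_lessThan:
  fixes c :: "nat \<Rightarrow> 'a::frame"
  assumes "\<And>i. complemented (c i)"
  shows "complemented (Sup (c ` {..<n}))"
  by (induction n) (simp_all add: complemented_bot complemented_sup assms lessThan_Suc)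

text \<open>Countable sets rather than sequences are used, so that the empty join, unions and images
  of products are covered directly; \<open>complemented_joinsE\<close> returns to sequences.\<close>

definition complemented_joins :: "'a::frame set" where
  "complemented_joins = {Sup C | C. countable C \<and> (\<forall>c\<in>C. complemented c)}"

lemma complemented_in_joins:
  assumes "complemented c" shows "c \<in> complemented_joins"
  unfolding complemented_joins_def
  by (intro CollectI exI[of _ "{c}"]) (simp add: assms)

text \<open>Choosing a countable family for each member of \<open>S\<close> and uniting them gives
  again a countable family.\<close>

lemma complemented_joins_Sup:
  assumes "countable S" "S \<subseteq> complemented_joins"
  shows "Sup S \<in> complemented_joins"
proof -
  have "\<forall>s\<in>S. \<exists>C. s = Sup C \<and> countable C \<and> (\<forall>c\<in>C. complemented c)"
    using assms(2) by (auto simp: complemented_joins_def)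
  then obtain C where C: "\<And>s. s \<in> S \<Longrightarrow> s = Sup (C s)" "\<And>s. s \<in> S \<Longrightarrow> countable (C s)"
      "\<And>s c. s \<in> S \<Longrightarrow> c \<in> C s \<Longrightarrow> complemented c"
    by metis
  have "Sup S = Sup (\<Union> (C ` S))"
  proof (rule antisym)
    show "Sup S \<le> Sup (\<Union> (C ` S))"
      by (rule Sup_least, subst C(1), assumption) (auto intro: Sup_subset_mono)
    show "Sup (\<Union> (C ` S)) \<le> Sup S"
      by (rule Sup_least) (metis C(1) Sup_upper Sup_upper2 UN_E)
  qed
  moreover have "countable (\<Union> (C ` S))" using assms(1) C(2) by auto
  ultimately show ?thesis using C(3) unfolding complemented_joins_def by blast
qed

text \<open>By the frame law the meet of two joins is the join of all pairwise meets, and there are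
  countably many pairs.\<close>

lemma complemented_joins_inf:
  assumes "a \<in> complemented_joins" "b \<in> complemented_joins"
  shows "inf a b \<in> complemented_joins"
proof -
  obtain C D where C: "a = Sup C" "countable C" "\<forall>c\<in>C. complemented c"
    and D: "b = Sup D" "countable D" "\<forall>d\<in>D. complemented d"
    using assms by (auto simp: complemented_joins_def)
  let ?E = "(\<lambda>(c, d). inf c d) ` (C \<times> D)"
  have "inf a b = Sup ?E"
  proof (rule antisym)
    show "inf a b \<le> Sup ?E"
      unfolding C(1) D(1) by (rule frame_inf_Sup_le) (auto intro: Sup_upper)
    show "Sup ?E \<le> inf a b"
      unfolding C(1) D(1) by (rule Sup_least) (auto intro: Sup_upper le_infI1 le_infI2)
  qed
  moreover have "countable ?E" using C(2) D(2) by blast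
  moreover have "\<forall>e\<in>?E. complemented e" using C(3) D(3) by (auto intro: complemented_inf)
  ultimately show ?thesis unfolding complemented_joins_def by blast
qed

lemma complemented_joinsE:
  assumes "a \<in> complemented_joins"
  obtains c :: "nat \<Rightarrow> 'a::frame" where "\<And>n. complemented (c n)" "a = Sup (range c)"
proof -
  obtain C where C: "a = Sup C" "countable C" "\<forall>c\<in>C. complemented c"
    using assms by (auto simp: complemented_joins_def)
  \<comment> \<open>Only a nonempty countable set is the range of a sequence; adding
    \<open>bot\<close> ensures this and leaves the join unchanged.\<close>
  obtain c :: "nat \<Rightarrow> 'a" where c: "insert bot C = range c"
    using uncountable_def[of "insert bot C"] C(2) by auto
  have "complemented (c n)" for n
    using rangeI[of c n] C(3) complemented_bot unfolding c[symmetric] by auto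
  moreover have "a = Sup (range c)" unfolding c[symmetric] by (simp add: C(1))
  ultimately show ?thesis by (rule that)
qed

section \<open>Cozero elements of functions with countable range\<close>

text \<open>The value of \<open>\<alpha>\<close> at \<open>(-,r)\<close>, for real \<open>r\<close>,
  whereas \<open>reals_below\<close> takes a rational. Bounding the right endpoint suffices, since a
  generator with \<open>b \<le> a\<close> is \<open>bot\<close>.\<close>

definition cut_below :: "(frame_of_reals \<Rightarrow> 'a::frame) \<Rightarrow> real \<Rightarrow> 'a" where
  "cut_below \<alpha> r = Sup {\<alpha> (rgen a b) | a b. of_rat b < r}"

definition cut_above :: "(frame_of_reals \<Rightarrow> 'a::frame) \<Rightarrow> real \<Rightarrow> 'a" where
  "cut_above \<alpha> r = Sup {\<alpha> (rgen a b) | a b. r < of_rat a}"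

lemma le_below: "of_rat b < r \<Longrightarrow> \<alpha> (rgen a b) \<le> cut_below \<alpha> r"
  unfolding cut_below_def by (blast intro: Sup_upper)

lemma le_above: "r < of_rat a \<Longrightarrow> \<alpha> (rgen a b) \<le> cut_above \<alpha> r"
  unfolding cut_above_def by (blast intro: Sup_upper)

lemma cut_below_mono: "r \<le> s \<Longrightarrow> cut_below \<alpha> r \<le> cut_below \<alpha> s"
  unfolding cut_below_def by (rule Sup_subset_mono) force

lemma cut_above_antimono: "r \<le> s \<Longrightarrow> cut_above \<alpha> s \<le> cut_above \<alpha> r"
  unfolding cut_above_def by (rule Sup_subset_mono) force

lemma Rfun_real_relations: "\<alpha> \<in> Rfun \<Longrightarrow> real_relations (\<lambda>p q. \<alpha> (rgen p q))"
  unfolding Rfun_def by (simp add: real_relations_frame_hom)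

lemma inf_below_above:
  assumes "\<alpha> \<in> Rfun" shows "inf (cut_below \<alpha> r) (cut_above \<alpha> r) = bot"
proof -
  note f = Rfun_real_relations[OF assms]
  have "inf (cut_below \<alpha> r) (cut_above \<alpha> r) \<le> bot"
    unfolding cut_below_def cut_above_def
  proof (rule frame_inf_Sup_le, clarify)
    fix a b c d assume "of_rat b < r" "r < of_rat c"
    then have "(of_rat b :: real) < of_rat c" by linarith
    then have "b < c" by (simp add: of_rat_less)
    then show "inf (\<alpha> (rgen a b)) (\<alpha> (rgen c d)) \<le> bot"
      by (simp add: real_relations1[OF f] real_relations_empty[OF f])
  qed
  then show ?thesis by (rule le_bot)
qed

lemma coz_eq:
  assumes "\<alpha> \<in> Rfun" shows "coz \<alpha> = sup (cut_below \<alpha> 0) (cut_above \<alpha> 0)"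
proof -
  note f = Rfun_real_relations[OF assms]
  have h: "\<alpha> (Sup S) = Sup (\<alpha> ` S)" for S
    using assms frame_homD(1) unfolding Rfun_def by blast
  have "\<alpha> (reals_below 0) = cut_below \<alpha> 0"
    unfolding reals_below_def h
  proof (rule antisym)
    show "Sup (\<alpha> ` {rgen r s | r s. r < 0 \<and> s < 0}) \<le> cut_below \<alpha> 0"
      by (rule Sup_least) (auto intro!: le_below)
    have "\<alpha> (rgen a b) \<le> Sup (\<alpha> ` {rgen r s | r s. r < 0 \<and> s < 0})" if "b < 0" for a b
    proof (cases "a < b")
      case True
      with that show ?thesis by (intro Sup_upper imageI CollectI exI[of _ a] exI[of _ b]) auto
    qed (simp add: real_relations_empty[OF f])
    then show "cut_below \<alpha> 0 \<le> Sup (\<alpha> ` {rgen r s | r s. r < 0 \<and> s < 0})"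
      unfolding cut_below_def by (auto intro!: Sup_least)
  qed
  moreover have "\<alpha> (reals_above 0) = cut_above \<alpha> 0"
    unfolding reals_above_def h
  proof (rule antisym)
    show "Sup (\<alpha> ` {rgen r s | r s. r > 0 \<and> s > 0}) \<le> cut_above \<alpha> 0"
      by (rule Sup_least) (auto intro!: le_above)
    have "\<alpha> (rgen a b) \<le> Sup (\<alpha> ` {rgen r s | r s. r > 0 \<and> s > 0})" if "0 < a" for a b
    proof (cases "a < b")
      case True
      with that show ?thesis by (intro Sup_upper imageI CollectI exI[of _ a] exI[of _ b]) auto
    qed (simp add: real_relations_empty[OF f])
    then show "cut_above \<alpha> 0 \<le> Sup (\<alpha> ` {rgen r s | r s. r > 0 \<and> s > 0})"
      unfolding cut_above_def by (auto intro!: Sup_least)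
  qed
  ultimately show ?thesis by (simp add: coz_def)
qed

text \<open>A constant takes only the values \<open>top\<close> and \<open>bot\<close>, so a term of
  the sum survives only if \<open>r\<close> lies strictly between \<open>- v\<close> and
  \<open>- u\<close>. It then equals \<open>\<alpha> (rgen a b)\<close>, and the inequalities for
  the sum become strict bounds shifted by \<open>r\<close>.\<close>

lemma Rminus_const_rgen:
  assumes "\<alpha> \<in> Rfun"
  shows "Rminus \<alpha> (Rconst r) (rgen p q) =
    Sup {\<alpha> (rgen a b) | a b. of_rat p + r < of_rat a \<and> a < b \<and> of_rat b < of_rat q + r}"
    (is "_ = Sup ?S")
proof -
  note C = Rconst_in_Rfun[of r]
  let ?k = "\<lambda>u v. if of_rat (- v) < r \<and> r < of_rat (- u) then top else bot"
  let ?R = "{inf (\<alpha> (rgen a b)) (?k u v) | a b u v. a < b \<and> u < v \<and> p \<le> a + u \<and> b + v \<le> q}"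
  have "Sup ?R = Sup ?S"
  proof (rule antisym)
    show "Sup ?R \<le> Sup ?S"
    proof (rule Sup_least, clarify)
      fix a b u v assume ab: "a < b" "u < v" "p \<le> a + u" "b + v \<le> q"
      have "(of_rat p :: real) \<le> of_rat a + of_rat u" "(of_rat b + of_rat v :: real) \<le> of_rat q"
        using ab by (auto simp: of_rat_less_eq simp flip: of_rat_add)
      then have "\<alpha> (rgen a b) \<le> Sup ?S" if "of_rat (- v) < r" "r < of_rat (- u)"
        using that ab(1) by (intro Sup_upper CollectI exI conjI refl) (auto simp: of_rat_minus)
      then show "inf (\<alpha> (rgen a b)) (?k u v) \<le> Sup ?S" by simp
    qed
    show "Sup ?S \<le> Sup ?R"
    proof (rule Sup_least, clarify)
      fix a b
      assume ab: "of_rat p + r < of_rat a" "a < b" "of_rat b < of_rat q + r"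
      have k: "of_rat (b - q) < r" "r < of_rat (a - p)"
        using ab by (auto simp: of_rat_diff)
      then have "(of_rat (b - q) :: real) < of_rat (a - p)" by linarith
      then have "b - q < a - p" by (simp only: of_rat_less)
      \<comment> \<open>With these witnesses the inequalities \<open>p \<le> a + u\<close> and
        \<open>b + v \<le> q\<close> become equalities, and \<open>k\<close> says that
        \<open>r\<close> lies in the required interval.\<close>
      with k ab(2) have "inf (\<alpha> (rgen a b)) (?k (p - a) (q - b)) \<in> ?R"
        by (intro CollectI exI[of _ a] exI[of _ b] exI[of _ "p - a"] exI[of _ "q - b"]) auto
      moreover have "inf (\<alpha> (rgen a b)) (?k (p - a) (q - b)) = \<alpha> (rgen a b)" using k by simp
      ultimately show "\<alpha> (rgen a b) \<le> Sup ?R" by (simp only: Sup_upper)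
    qed
  qed
  then show ?thesis
    unfolding Rminus_def Rplus_rgen[OF assms Runeg_in_Rfun[OF C]] Runeg_rgen[OF C] Rconst_rgen .
qed

text \<open>Subtracting \<open>r\<close> moves the cuts at \<open>r\<close> to \<open>0\<close>.
  Hence \<open>Rset \<alpha>\<close> consists of those \<open>r\<close> at which the two cuts of
  \<open>\<alpha>\<close> fail to cover \<open>top\<close>.\<close>

lemma coz_Rminus_const:
  assumes "\<alpha> \<in> Rfun"
  shows "coz (Rminus \<alpha> (Rconst r)) = sup (cut_below \<alpha> r) (cut_above \<alpha> r)"
proof -
  let ?\<beta> = "Rminus \<alpha> (Rconst r)"
  note f = Rfun_real_relations[OF assms]
  have \<beta>: "?\<beta> \<in> Rfun"
    unfolding Rminus_def by (intro Rplus_in_Rfun Runeg_in_Rfun Rconst_in_Rfun assms)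
  have le: "\<alpha> (rgen a b) \<le> ?\<beta> (rgen p q)"
    if "of_rat p + r < of_rat a" "of_rat b < of_rat q + r" for a b p q
  proof (cases "a < b")
    case True
    with that show ?thesis
      unfolding Rminus_const_rgen[OF assms] by (intro Sup_upper) blast
  qed (simp add: real_relations_empty[OF f])
  \<comment> \<open>The endpoint away from the cut only has to be far enough out.\<close>
  have low: "\<exists>p. of_rat p + r < x" for x :: real
    using of_rat_dense[of "x - r - 1" "x - r"] by (auto simp: algebra_simps)
  have high: "\<exists>q. x < of_rat q + r" for x :: real
    using of_rat_dense[of "x - r" "x - r + 1"] by (auto simp: algebra_simps)
  have "cut_below ?\<beta> 0 = cut_below \<alpha> r"
  proof (rule antisym)
    show "cut_below ?\<beta> 0 \<le> cut_below \<alpha> r"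
      unfolding cut_below_def[of ?\<beta>] Rminus_const_rgen[OF assms]
      by (auto simp del: of_rat_less_0_iff intro!: Sup_least le_below)
    show "cut_below \<alpha> r \<le> cut_below ?\<beta> 0"
      unfolding cut_below_def[of \<alpha>]
    proof (rule Sup_least, clarify)
      fix a b assume b: "of_rat b < r"
      obtain p where "of_rat p + r < of_rat a" using low by blast
      moreover obtain q where "of_rat b - r < of_rat q" "of_rat q < (0 :: real)"
        using of_rat_dense[of "of_rat b - r" 0] b by auto
      ultimately show "\<alpha> (rgen a b) \<le> cut_below ?\<beta> 0"
        by (intro order_trans[OF le[of p a b q] le_below[of q 0 ?\<beta>]]) auto
    qed
  qed
  moreover have "cut_above ?\<beta> 0 = cut_above \<alpha> r"
  proof (rule antisym)
    show "cut_above ?\<beta> 0 \<le> cut_above \<alpha> r"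
      unfolding cut_above_def[of ?\<beta>] Rminus_const_rgen[OF assms]
      by (auto simp del: zero_less_of_rat_iff intro!: Sup_least le_above)
    show "cut_above \<alpha> r \<le> cut_above ?\<beta> 0"
      unfolding cut_above_def[of \<alpha>]
    proof (rule Sup_least, clarify)
      fix a b assume a: "r < of_rat a"
      obtain q where "of_rat b < of_rat q + r" using high by blast
      moreover obtain p where "0 < (of_rat p :: real)" "of_rat p < of_rat a - r"
        using of_rat_dense[of 0 "of_rat a - r"] a by auto
      ultimately show "\<alpha> (rgen a b) \<le> cut_above ?\<beta> 0"
        by (intro order_trans[OF le[of p a b q] le_above[of 0 p ?\<beta>]]) auto
    qed
  qed
  ultimately show ?thesis using coz_eq[OF \<beta>] by simp
qed

lemma complements_below_above:
  assumes "\<alpha> \<in> Rfun" "r \<notin> Rset \<alpha>"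
  shows "complements (cut_below \<alpha> r) (cut_above \<alpha> r)"
  using assms inf_below_above[OF assms(1)] coz_Rminus_const[OF assms(1)]
  by (simp add: complements_def Rset_def)

lemma coz_in_complemented_joins:
  assumes "\<alpha> \<in> Cc" shows "coz \<alpha> \<in> complemented_joins"
proof -
  have \<alpha>: "\<alpha> \<in> Rfun" and R: "countable (Rset \<alpha>)" using assms by (auto simp: Cc_def)
  \<comment> \<open>A nonempty open interval is uncountable, so it cannot lie inside
    \<open>Rset \<alpha>\<close>.\<close>
  have gap: "\<exists>t. x < t \<and> t < y \<and> t \<notin> Rset \<alpha>" if "x < y" for x y
  proof (rule ccontr)
    assume "\<not> ?thesis"
    then have "{x<..<y} \<subseteq> Rset \<alpha>" by auto
    then show False using R that uncountable_open_interval countable_subset by blast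
  qed
  have "\<forall>x. \<exists>t. 0 < x \<longrightarrow> 0 < t \<and> t < x \<and> t \<notin> Rset \<alpha>" using gap by blast
  then obtain u where u: "\<And>x. 0 < x \<Longrightarrow> 0 < u x \<and> u x < x \<and> u x \<notin> Rset \<alpha>" by metis
  have "\<forall>x. \<exists>t. x < 0 \<longrightarrow> x < t \<and> t < 0 \<and> t \<notin> Rset \<alpha>" using gap by blast
  then obtain l where l: "\<And>x. x < 0 \<Longrightarrow> x < l x \<and> l x < 0 \<and> l x \<notin> Rset \<alpha>" by metis
  \<comment> \<open>Indexing by rationals keeps the family countable. A generator ending at
    \<open>b < 0\<close> lies below the cut at \<open>l b\<close>, because
    \<open>b < l b < 0\<close>; the positive side is symmetric.\<close>
  let ?C = "(\<lambda>b. cut_below \<alpha> (l (of_rat b))) ` {b. b < 0} \<union> (\<lambda>a. cut_above \<alpha> (u (of_rat a))) ` {a. 0 < a}"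
  have "coz \<alpha> = Sup ?C"
    unfolding coz_eq[OF \<alpha>]
  proof (rule antisym)
    have "\<alpha> (rgen a b) \<le> Sup ?C" if "b < 0" for a b
      by (rule order_trans[OF le_below[of b "l (of_rat b)"] Sup_upper])
        (use that l[of "of_rat b"] in auto)
    moreover have "\<alpha> (rgen a b) \<le> Sup ?C" if "0 < a" for a b
      by (rule order_trans[OF le_above[of "u (of_rat a)" a] Sup_upper])
        (use that u[of "of_rat a"] in auto)
    ultimately show "sup (cut_below \<alpha> 0) (cut_above \<alpha> 0) \<le> Sup ?C"
      unfolding cut_below_def cut_above_def by (auto intro!: Sup_least)
    show "Sup ?C \<le> sup (cut_below \<alpha> 0) (cut_above \<alpha> 0)"
    proof (rule Sup_least)
      fix x assume "x \<in> ?C"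
      then consider b where "b < 0" "x = cut_below \<alpha> (l (of_rat b))"
        | a where "0 < a" "x = cut_above \<alpha> (u (of_rat a))" by auto
      then show "x \<le> sup (cut_below \<alpha> 0) (cut_above \<alpha> 0)"
      proof cases
        case 1
        then show ?thesis using l[of "of_rat b"] by (auto intro!: le_supI1 cut_below_mono)
      next
        case 2
        then show ?thesis using u[of "of_rat a"] by (auto intro!: le_supI2 cut_above_antimono)
      qed
    qed
  qed
  moreover have "countable ?C" by simp
  moreover have "\<forall>c\<in>?C. complemented c"
  proof
    fix c assume "c \<in> ?C"
    then consider b where "b < 0" "c = cut_below \<alpha> (l (of_rat b))"
      | a where "0 < a" "c = cut_above \<alpha> (u (of_rat a))" by auto
    then show "complemented c"
    proof cases
      case 1
      then show ?thesis
        using l[of "of_rat b"] complements_below_above[OF \<alpha>] unfolding complemented_def by auto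
    next
      case 2
      then show ?thesis
        using u[of "of_rat a"] complements_sym[OF complements_below_above[OF \<alpha>]]
        unfolding complemented_def by auto
    qed
  qed
  ultimately show ?thesis unfolding complemented_joins_def by blast
qed

section \<open>Step functions\<close>

text \<open>Builds a function from its cuts, with \<open>U p\<close> as the value at
  \<open>(p,-)\<close> and \<open>D q\<close> at \<open>(-,q)\<close>. The hypotheses
  \<open>U\<close> and \<open>D\<close> are the continuity that (R3) asks for; \<open>cover\<close>
  yields (R2).\<close>

lemma real_relations_cuts:
  fixes U D :: "rat \<Rightarrow> 'a::frame"
  assumes "antimono U" "mono D"
    and U: "\<And>p. U p \<le> Sup (U ` {p<..})" and D: "\<And>q. D q \<le> Sup (D ` {..<q})"
    and "top \<le> Sup (range U)" "top \<le> Sup (range D)"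
    and disj: "\<And>p q. q \<le> p \<Longrightarrow> inf (U p) (D q) = bot"
    and cover: "\<And>p q. p < q \<Longrightarrow> sup (U p) (D q) = top"
  shows "real_relations (\<lambda>p q. inf (U p) (D q))"
proof (rule real_relationsI)
  fix p q r s :: rat
  show "inf (U r) (D s) \<le> inf (U p) (D q)" if "p \<le> r" "s \<le> q"
    using that assms(1,2) by (intro inf_mono) (auto dest: antimonoD monoD)
  show "inf (inf (U p) (D q)) (inf (U r) (D s)) \<le> inf (U (max p r)) (D (min q s))"
    by (auto simp: max_def min_def le_infI1 le_infI2)
  show "inf (U p) (D s) \<le> sup (inf (U p) (D q)) (inf (U r) (D s))" if "p \<le> r" "r < q" "q \<le> s"
  proof -
    \<comment> \<open>As \<open>r < q\<close>, the added factor is \<open>top\<close>; distributing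
      over it yields the two overlapping pieces.\<close>
    have "inf (U p) (D s) = inf (inf (U p) (D s)) (sup (D q) (U r))"
      using cover[OF that(2)] by (simp add: sup_commute)
    also have "\<dots> \<le> sup (inf (U p) (D q)) (inf (U r) (D s))"
      unfolding inf_sup_distrib1 by (intro sup_mono) (auto intro: le_infI1)
    finally show ?thesis .
  qed
  show "inf (U p) (D q) \<le> Sup {inf (U r) (D s) | r s. p < r \<and> r < s \<and> s < q}" (is "_ \<le> Sup ?S")
  proof (rule order_trans[OF inf_mono[OF U D]], rule frame_inf_Sup_le, clarify)
    fix r s assume "p < r" "s < q"
    \<comment> \<open>A pair with \<open>s \<le> r\<close> is not among those in \<open>?S\<close>,
      but its meet is \<open>bot\<close> by \<open>disj\<close>.\<close>
    then show "inf (U r) (D s) \<le> Sup ?S"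
      using disj[of s r] by (cases "r < s") (auto intro!: Sup_upper)
  qed
next
  have "inf (Sup (range U)) (Sup (range D)) \<le> Sup {inf (U p) (D q) | p q. True}"
    by (rule frame_inf_Sup_le) (auto intro!: Sup_upper)
  then show "top \<le> Sup {inf (U p) (D q) | p q. True}"
    using assms(5,6) by (simp add: top_unique)
qed

text \<open>The two cuts of the function with value \<open>1/n\<close> on \<open>d n \<setminus> d (n - 1)\<close>, where \<open>e n\<close> is the
  complement of \<open>d n\<close> and \<open>d 0 = bot\<close>. Rational division has \<open>1/0 = 0\<close>, whence the condition
  \<open>0 < n\<close>.\<close>

definition step_upper :: "(nat \<Rightarrow> 'a::frame) \<Rightarrow> rat \<Rightarrow> 'a" where
  "step_upper d p = (if p < 0 then top else Sup (d ` {n. 0 < n \<and> p < 1 / of_nat n}))"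

definition step_lower :: "(nat \<Rightarrow> 'a::frame) \<Rightarrow> rat \<Rightarrow> 'a" where
  "step_lower e q = Sup (e ` {n. 1 / of_nat (Suc n) < q})"

text \<open>Take the least \<open>n\<close> with \<open>1 / (n + 1) < q\<close>; for
  \<open>n = 0\<close> there is no upper bound. The general field allows rational \<open>q\<close>
  in the relations and real \<open>q\<close> when computing \<open>Rset\<close>.\<close>

lemma between_reciprocals:
  fixes q :: "'b::archimedean_field"
  assumes "0 < q"
  obtains n where "1 / of_nat (Suc n) < q" "n = 0 \<or> q \<le> 1 / of_nat n"
proof -
  define n where "n = (LEAST n. 1 / of_nat (Suc n) < q)"
  obtain k where "inverse (of_nat (Suc k)) < q" using reals_Archimedean[OF assms] by blast
  then have k: "1 / of_nat (Suc k) < q" by (simp add: inverse_eq_divide)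
  have "1 / of_nat (Suc n) < q" unfolding n_def by (rule LeastI[of _ k]) (rule k)
  moreover have "q \<le> 1 / of_nat n" if "n = Suc m" for m
  proof -
    have "m < n" using that by simp
    then have "\<not> 1 / of_nat (Suc m) < q" unfolding n_def by (rule not_less_Least)
    then show ?thesis using that by simp
  qed
  then have "n = 0 \<or> q \<le> 1 / of_nat n" by (cases n) auto
  ultimately show ?thesis by (rule that)
qed

context
  fixes d e :: "nat \<Rightarrow> 'a::frame"
  assumes d0: "d 0 = bot" and mono_d: "mono d" and de: "\<And>n. complements (d n) (e n)"
begin

definition step :: "frame_of_reals \<Rightarrow> 'a" where
  "step = hom_of (\<lambda>p q. inf (step_upper d p) (step_lower e q))"

lemma e0: "e 0 = top"
  using de[of 0] d0 by (simp add: complements_def)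

lemma le_step_upper: "0 < n \<Longrightarrow> p < 1 / of_nat n \<Longrightarrow> d n \<le> step_upper d p"
  unfolding step_upper_def by (auto intro!: Sup_upper)

lemma le_step_lower: "1 / of_nat (Suc n) < q \<Longrightarrow> e n \<le> step_lower e q"
  unfolding step_lower_def by (rule Sup_upper) blast

lemma step_upper_neg: "p < 0 \<Longrightarrow> step_upper d p = top"
  by (simp add: step_upper_def)

lemma step_lower_gt_1: "1 < q \<Longrightarrow> step_lower e q = top"
  \<comment> \<open>The index \<open>0\<close> suffices: its threshold is \<open>1\<close>, and
    \<open>e 0 = top\<close>.\<close>
  using le_step_lower[of 0 q] e0 by (simp add: top_le)

lemma step_lower_nonpos:
  assumes "q \<le> 0" shows "step_lower e q = bot"
proof -
  have "\<not> 1 / of_nat (Suc n) < q" for n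
    using assms by (metis divide_nonneg_nonneg not_less of_nat_0_le_iff order_trans zero_le_one)
  then have "{n. 1 / of_nat (Suc n) < q} = {}" by blast
  then show ?thesis by (simp only: step_lower_def image_empty Sup_empty)
qed

lemma real_relations_step: "real_relations (\<lambda>p q. inf (step_upper d p) (step_lower e q))"
proof (rule real_relations_cuts)
  show "antimono (step_upper d)"
    by (rule antimonoI) (auto simp: step_upper_def intro!: Sup_subset_mono)
  show "mono (step_lower e)"
    by (rule monoI) (auto simp: step_lower_def intro!: Sup_subset_mono)
  show "step_upper d p \<le> Sup (step_upper d ` {p<..})" for p
  proof (cases "p < 0")
    case True
    then have "step_upper d (p / 2) = top" "p / 2 \<in> {p<..}" by (auto simp: step_upper_neg)
    then show ?thesis by (metis Sup_upper imageI top_greatest top_le)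
  next
    case False
    have "d n \<le> Sup (step_upper d ` {p<..})" if n: "0 < n" "p < 1 / of_nat n" for n
    proof -
      obtain p' where p': "p < p'" "p' < 1 / of_nat n" using dense n(2) by blast
      show ?thesis
        by (rule order_trans[OF le_step_upper[OF n(1) p'(2)] Sup_upper]) (use p'(1) in simp)
    qed
    then show ?thesis using False by (auto simp: step_upper_def[of d p] intro!: Sup_least)
  qed
  show "step_lower e q \<le> Sup (step_lower e ` {..<q})" for q
    unfolding step_lower_def[of e q]
  proof (rule Sup_least, clarify)
    fix n assume "1 / of_nat (Suc n) < q"
    then obtain q' where q': "1 / of_nat (Suc n) < q'" "q' < q" using dense by blast
    show "e n \<le> Sup (step_lower e ` {..<q})"
      by (rule order_trans[OF le_step_lower[OF q'(1)] Sup_upper]) (use q'(2) in simp)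
  qed
  show "top \<le> Sup (range (step_upper d))"
    using Sup_upper[OF rangeI, of "step_upper d" "- 1"] by (simp add: step_upper_neg)
  show "top \<le> Sup (range (step_lower e))"
    using Sup_upper[OF rangeI, of "step_lower e" 2] by (simp add: step_lower_gt_1)
  show "inf (step_upper d p) (step_lower e q) = bot" if "q \<le> p" for p q
  proof (cases "p < 0")
    case True
    then show ?thesis using that by (simp add: step_lower_nonpos)
  next
    case False
    have "inf (Sup (d ` {n. 0 < n \<and> p < 1 / of_nat n})) (step_lower e q) \<le> bot"
      unfolding step_lower_def
    proof (rule frame_inf_Sup_le, clarify)
      fix n m assume n: "0 < n" "p < 1 / of_nat n" and m: "1 / of_nat (Suc m) < q"
      \<comment> \<open>From \<open>1 / (m + 1) < q \<le> p < 1 / n\<close> follows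
        \<open>n \<le> m\<close>, so \<open>d n\<close> lies below \<open>d m\<close>, which is
        disjoint from \<open>e m\<close>.\<close>
      have "(1 :: rat) / of_nat (Suc m) < 1 / of_nat n" using n m that by linarith
      then have "(of_nat n :: rat) < of_nat (Suc m)" using n(1) by (simp add: field_simps)
      then have "n \<le> m" by (simp only: of_nat_less_iff)
      then have "d n \<le> d m" using mono_d by (auto dest: monoD)
      then have "inf (d n) (e m) \<le> inf (d m) (e m)" by (intro inf_mono) auto
      also have "\<dots> = bot" using de[of m] by (simp add: complements_def)
      finally show "inf (d n) (e m) \<le> bot" .
    qed
    then show ?thesis using False by (simp add: step_upper_def le_bot)
  qed
  show "sup (step_upper d p) (step_lower e q) = top" if pq: "p < q" for p q
  proof (cases "p < 0")
    case True
    then show ?thesis by (simp add: step_upper_neg)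
  next
    case False
    then have "0 < q" using pq by simp
    then obtain n where n: "1 / of_nat (Suc n) < q" "n = 0 \<or> q \<le> 1 / of_nat n"
      by (rule between_reciprocals)
    \<comment> \<open>Here \<open>p < q \<le> 1 / n\<close> if \<open>n\<close> is positive, and
      \<open>d 0 = bot\<close> otherwise. The same \<open>n\<close> puts \<open>e n\<close> below
      the lower cut, so the complements \<open>d n\<close> and \<open>e n\<close> cover
      \<open>top\<close>.\<close>
    have "d n \<le> step_upper d p"
      using n(2) pq le_step_upper[of n p] d0 by (cases n) auto
    then show ?thesis using le_step_lower[OF n(1)] by (rule complements_sup_top[OF de])
  qed
qed

lemma step_in_Rfun: "step \<in> Rfun"
  unfolding step_def Rfun_def using frame_hom_hom_of[OF real_relations_step] by simp

lemma step_rgen: "step (rgen p q) = inf (step_upper d p) (step_lower e q)"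
  unfolding step_def by (rule hom_of_rgen[OF real_relations_step])

text \<open>The values of the function lie between \<open>0\<close> and \<open>1\<close>, so the
  right endpoint \<open>2\<close> makes the other factor \<open>top\<close>; in the next lemma the
  left endpoint \<open>- 1\<close> does the same.\<close>

lemma step_upper_le_above: "r < of_rat p \<Longrightarrow> step_upper d p \<le> cut_above step r"
  using le_above[of r p step 2] by (simp add: step_rgen step_lower_gt_1)

lemma step_lower_le_below: "of_rat q < r \<Longrightarrow> step_lower e q \<le> cut_below step r"
  using le_below[of q r step "- 1"] by (simp add: step_rgen step_upper_neg)

lemma coz_step: "coz step = Sup (range d)"
proof -
  have "cut_below step 0 = bot"
    unfolding cut_below_def step_rgen by (rule le_bot, rule Sup_least) (auto simp: step_lower_nonpos)
  moreover have "cut_above step 0 = Sup (range d)"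
  proof (rule antisym)
    show "cut_above step 0 \<le> Sup (range d)"
      unfolding cut_above_def step_rgen
    proof (rule Sup_least, clarify)
      fix a b assume "0 < (of_rat a :: real)"
      then show "inf (step_upper d a) (step_lower e b) \<le> Sup (range d)"
        by (intro le_infI1) (auto simp: step_upper_def intro!: Sup_subset_mono)
    qed
    show "Sup (range d) \<le> cut_above step 0"
    proof (rule Sup_least, clarify)
      fix n
      show "d n \<le> cut_above step 0"
      proof (cases "n = 0")
        case False
        \<comment> \<open>\<open>1 / (n + 1)\<close> serves as a positive rational below the value
          \<open>1 / n\<close>.\<close>
        have "d n \<le> step_upper d (1 / of_nat (Suc n))"
          using False by (intro le_step_upper) (auto simp: field_simps)
        also have "\<dots> \<le> cut_above step 0" by (rule step_upper_le_above) simp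
        finally show ?thesis .
      qed (simp add: d0)
    qed
  qed
  ultimately show ?thesis using coz_eq[OF step_in_Rfun] by simp
qed

text \<open>The value \<open>0\<close> enters at \<open>n = 0\<close>, as \<open>1 / 0 = 0\<close>.
  Any other \<open>r\<close> outside the range is negative, exceeds \<open>1\<close>, or lies
  strictly between consecutive reciprocals; in each case the two cuts at \<open>r\<close> cover
  \<open>top\<close>.\<close>

lemma Rset_step: "Rset step \<subseteq> range (\<lambda>n. 1 / real n)"
proof
  fix r assume r: "r \<in> Rset step"
  show "r \<in> range (\<lambda>n. 1 / real n)"
  proof (rule ccontr)
    assume nr: "r \<notin> range (\<lambda>n. 1 / real n)"
    then have "r \<noteq> 1 / real 0" by blast
    then consider "r < 0" | "0 < r" by fastforce
    then have "sup (cut_below step r) (cut_above step r) = top"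
    proof cases
      case 1
      then obtain p where p: "r < of_rat p" "of_rat p < (0 :: real)" using of_rat_dense by blast
      then have "step_upper d p = top" by (simp add: step_upper_neg)
      then show ?thesis using step_upper_le_above[OF p(1)] by (simp add: top_unique)
    next
      case 2
      then obtain n where n: "1 / of_nat (Suc n) < r" "n = 0 \<or> r \<le> 1 / of_nat n"
        by (rule between_reciprocals)
      obtain q where q: "1 / of_nat (Suc n) < (of_rat q :: real)" "of_rat q < r"
        using of_rat_dense n(1) by blast
      have "(of_rat (1 / of_nat (Suc n)) :: real) < of_rat q"
        using q(1) by (simp add: of_rat_divide del: of_nat_Suc)
      then have "e n \<le> step_lower e q" unfolding of_rat_less by (rule le_step_lower)
      then have e: "e n \<le> cut_below step r" using step_lower_le_below[OF q(2)] by simp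
      have "d n \<le> cut_above step r"
      proof (cases "n = 0")
        case False
        \<comment> \<open>This makes \<open>r \<le> 1 / n\<close> strict and leaves room for a
          rational \<open>p\<close> in between.\<close>
        have "r \<noteq> 1 / real n" using nr by blast
        then have "r < 1 / real n" using n(2) False by simp
        then obtain p where p: "r < of_rat p" "(of_rat p :: real) < 1 / of_nat n"
          using of_rat_dense by blast
        have "(of_rat p :: real) < of_rat (1 / of_nat n)" using p(2) by (simp add: of_rat_divide)
        then have "d n \<le> step_upper d p"
          unfolding of_rat_less using False by (intro le_step_upper) auto
        then show ?thesis using step_upper_le_above[OF p(1)] by simp
      qed (simp add: d0)
      with e show ?thesis by (rule complements_sup_top[OF complements_sym[OF de]])
    qed
    then show False using r coz_Rminus_const[OF step_in_Rfun] by (simp add: Rset_def)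
  qed
qed

lemma step_in_Cc: "step \<in> Cc"
  using step_in_Rfun countable_subset[OF Rset_step] by (simp add: Cc_def)

end

text \<open>After this, closure and regularity of \<open>Coz_c\<close> are questions about
  complemented elements, without real-valued functions.\<close>

theorem Coz_c_eq: "(Coz_c :: 'a::frame set) = complemented_joins"
proof
  show "Coz_c \<subseteq> complemented_joins"
    unfolding Coz_c_def using coz_in_complemented_joins by blast
  show "complemented_joins \<subseteq> (Coz_c :: 'a set)"
  proof
    fix a :: 'a assume "a \<in> complemented_joins"
    then obtain c :: "nat \<Rightarrow> 'a" where c: "\<And>n. complemented (c n)" "a = Sup (range c)"
      by (rule complemented_joinsE) blast
    \<comment> \<open>Partial joins make the sequence increasing, and the strict bound gives
      \<open>d 0 = bot\<close>, as the step function requires.\<close>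
    define d where "d n = Sup (c ` {..<n})" for n :: nat
    have "\<forall>n. \<exists>e. complements (d n) e"
      using complemented_SUP_lessThan[of c] c(1) unfolding d_def complemented_def by blast
    then obtain e where e: "\<And>n. complements (d n) (e n)" by metis
    have d: "d 0 = bot" "mono d"
      unfolding d_def by (auto intro!: monoI Sup_subset_mono)
    have "a = Sup (range d)"
    proof (rule antisym)
      have "c n \<le> d (Suc n)" for n unfolding d_def by (rule Sup_upper) simp
      then show "a \<le> Sup (range d)"
        unfolding c(2) by (auto intro!: Sup_least intro: Sup_upper2)
      show "Sup (range d) \<le> a"
        unfolding c(2) d_def by (auto intro!: Sup_least intro: Sup_upper)
    qed
    then show "a \<in> Coz_c"
      using coz_step[OF d e] step_in_Cc[OF d e] unfolding Coz_c_def by (metis imageI)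
  qed
qed

section \<open>Sub-sigma-frames of a frame\<close>

text \<open>A subset closed under the countable joins and finite meets of the frame; its bottom is
  the empty join. The operations of the subposet then agree with those of the frame, so the
  distributive laws are inherited.\<close>

locale sub_sigma_frame =
  fixes A :: "'a::frame set"
  assumes Sup_mem: "\<And>S. countable S \<Longrightarrow> S \<subseteq> A \<Longrightarrow> Sup S \<in> A"
    and inf_mem: "\<And>x y. x \<in> A \<Longrightarrow> y \<in> A \<Longrightarrow> inf x y \<in> A"
    and top_mem: "top \<in> A"
begin

abbreviation P :: "'a gorder" where "P \<equiv> subposet A"

lemma subposet_simps: "carrier P = A" "eq P = (=)" "le P = (\<le>)"
  by (simp_all add: subposet_def)

lemma bot_mem: "bot \<in> A"
  using Sup_mem[of "{}"] by simp

lemma partial_order_subposet: "partial_order P"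
  by unfold_locales (auto simp: subposet_simps)

interpretation partial_order P by (rule partial_order_subposet)

lemma least_Sup: "countable S \<Longrightarrow> S \<subseteq> A \<Longrightarrow> least P (Sup S) (Upper P S)"
  using Sup_mem[of S] by (auto simp: least_def Upper_def subposet_simps intro: Sup_upper Sup_least)

lemma greatest_inf: "x \<in> A \<Longrightarrow> y \<in> A \<Longrightarrow> greatest P (inf x y) (Lower P {x, y})"
  using inf_mem[of x y] by (auto simp: greatest_def Lower_def subposet_simps)

lemma least_bot: "least P bot (carrier P)"
  using bot_mem by (simp add: least_def subposet_simps)

lemma greatest_top: "greatest P top (carrier P)"
  using top_mem by (simp add: greatest_def subposet_simps)

text \<open>The order-theoretic join is a chosen least upper bound; uniqueness of least elements
  identifies it. The meet, bottom and top are treated alike.\<close>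

lemma join_Sup: "countable S \<Longrightarrow> S \<subseteq> A \<Longrightarrow> \<Squnion>\<^bsub>P\<^esub>S = Sup S"
  unfolding Lattice.sup_def by (rule some_equality) (use least_Sup least_unique in blast)+

lemma join_eq: "x \<in> A \<Longrightarrow> y \<in> A \<Longrightarrow> x \<squnion>\<^bsub>P\<^esub> y = sup x y"
  unfolding join_def by (simp add: join_Sup)

lemma meet_eq: "x \<in> A \<Longrightarrow> y \<in> A \<Longrightarrow> x \<sqinter>\<^bsub>P\<^esub> y = inf x y"
  unfolding meet_def Lattice.inf_def
  by (rule some_equality) (use greatest_inf greatest_unique in blast)+

lemma bottom_eq: "\<bottom>\<^bsub>P\<^esub> = bot"
  unfolding Order.bottom_def by (rule some_equality) (use least_bot least_unique in blast)+

lemma top_eq: "\<top>\<^bsub>P\<^esub> = top"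
  unfolding Order.top_def by (rule some_equality) (use greatest_top greatest_unique in blast)+

lemma sup_mem: "x \<in> A \<Longrightarrow> y \<in> A \<Longrightarrow> sup x y \<in> A"
  using Sup_mem[of "{x, y}"] by simp

lemma meet_countable_join:
  assumes a: "a \<in> A" and S: "countable S" "S \<subseteq> A"
  shows "a \<sqinter>\<^bsub>P\<^esub> (\<Squnion>\<^bsub>P\<^esub>S) = \<Squnion>\<^bsub>P\<^esub>((\<lambda>s. a \<sqinter>\<^bsub>P\<^esub> s) ` S)"
proof -
  have img: "(\<lambda>s. a \<sqinter>\<^bsub>P\<^esub> s) ` S = inf a ` S"
    by (rule image_cong[OF HOL.refl], rule meet_eq[OF a]) (use S in blast)
  have "a \<sqinter>\<^bsub>P\<^esub> (\<Squnion>\<^bsub>P\<^esub>S) = inf a (Sup S)"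
    by (simp only: join_Sup[OF S] meet_eq[OF a Sup_mem[OF S]])
  also have "\<dots> = Sup (inf a ` S)" by (rule inf_Sup_frame)
  also have "\<dots> = \<Squnion>\<^bsub>P\<^esub>(inf a ` S)"
    by (rule join_Sup[symmetric]) (use S a inf_mem in auto)
  finally show ?thesis unfolding img .
qed

lemma bounded_lattice_subposet: "bounded_lattice P"
proof (intro bounded_lattice.intro lattice.intro upper_semilattice.intro lower_semilattice.intro
    upper_semilattice_axioms.intro lower_semilattice_axioms.intro partial_order_subposet
    weak_partial_order_bottom.intro weak_partial_order_top.intro weak_partial_order_axioms
    weak_partial_order_bottom_axioms.intro weak_partial_order_top_axioms.intro)
  show "\<exists>x. least P x (carrier P)" using least_bot by blast
  show "\<exists>x. greatest P x (carrier P)" using greatest_top by blast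
  fix x y assume "x \<in> carrier P" "y \<in> carrier P"
  then have xy: "x \<in> A" "y \<in> A" by (simp_all add: subposet_simps)
  show "\<exists>s. least P s (Upper P {x, y})" using least_Sup[of "{x, y}"] xy by blast
  show "\<exists>s. greatest P s (Lower P {x, y})" using greatest_inf xy by blast
qed

lemma sigma_frame_subposet: "sigma_frame P"
proof (rule sigma_frame.intro[OF bounded_lattice_subposet], rule sigma_frame_axioms.intro,
    unfold subposet_simps)
  fix x y z assume xyz: "x \<in> A" "y \<in> A" "z \<in> A"
  show "x \<sqinter>\<^bsub>P\<^esub> (y \<squnion>\<^bsub>P\<^esub> z) = x \<sqinter>\<^bsub>P\<^esub> y \<squnion>\<^bsub>P\<^esub> x \<sqinter>\<^bsub>P\<^esub> z"
    using xyz by (simp add: join_eq meet_eq sup_mem inf_mem inf_sup_distrib1)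
next
  fix S assume S: "S \<subseteq> A" "countable S"
  show "\<exists>s. least P s (Upper P S)" using least_Sup[OF S(2,1)] by blast
next
  fix a S assume "a \<in> A" "S \<subseteq> A" "countable S"
  then show "a \<sqinter>\<^bsub>P\<^esub> (\<Squnion>\<^bsub>P\<^esub>S) = \<Squnion>\<^bsub>P\<^esub>((\<lambda>s. a \<sqinter>\<^bsub>P\<^esub> s) ` S)"
    by (intro meet_countable_join)
qed

lemma rather_belowI:
  assumes "a \<in> A" "b \<in> A" "x \<in> A" "inf a x = bot" "sup x b = top"
  shows "rather_below P a b"
  using assms by (auto simp: rather_below_def subposet_simps meet_eq join_eq bottom_eq top_eq)

end

section \<open>Regularity, with complemented elements as the approximating sequence\<close>

theorem corollary6p7:
  assumes "completely_regular TYPE('a::frame)"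
  shows "regular_sigma_frame (subposet (Coz_c :: 'a set))"
proof -
  interpret sub_sigma_frame "Coz_c :: 'a set"
    unfolding Coz_c_eq
    by unfold_locales
      (simp_all add: complemented_joins_Sup complemented_joins_inf complemented_in_joins
        complemented_top)
  have "\<exists>s :: nat \<Rightarrow> 'a. (\<forall>n. s n \<in> Coz_c \<and> rather_below P (s n) a) \<and> a = \<Squnion>\<^bsub>P\<^esub>(range s)"
    if a: "a \<in> Coz_c" for a :: 'a
  proof -
    obtain c :: "nat \<Rightarrow> 'a" where c: "\<And>n. complemented (c n)" "a = Sup (range c)"
      using a unfolding Coz_c_eq by (rule complemented_joinsE) blast
    have mem: "c n \<in> Coz_c" for n
      unfolding Coz_c_eq by (rule complemented_in_joins[OF c(1)])
    have rather: "rather_below P (c n) a" for n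
    proof -
      obtain x where x: "complements (c n) x" using c(1) unfolding complemented_def by blast
      \<comment> \<open>The witness for \<open>rather_below\<close> has to lie in
        \<open>Coz_c\<close> itself; the complement \<open>x\<close> does, being complemented in
        turn.\<close>
      have "x \<in> Coz_c"
        unfolding Coz_c_eq using complements_sym[OF x]
        by (intro complemented_in_joins) (auto simp: complemented_def)
      moreover have "c n \<le> a" unfolding c(2) by (rule Sup_upper) simp
      then have "sup x a = top" by (intro complements_sup_top[OF complements_sym[OF x]]) simp_all
      ultimately show ?thesis
        using x a mem by (intro rather_belowI[of _ _ x]) (simp_all add: complements_def)
    qed
    have join: "a = \<Squnion>\<^bsub>P\<^esub>(range c)"
      unfolding c(2) by (rule join_Sup[symmetric]) (use mem in auto)
    show ?thesis by (intro exI[of _ c] conjI allI mem rather join)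
  qed
  then show ?thesis
    unfolding regular_sigma_frame_def regular_sigma_frame_axioms_def
    by (simp add: sigma_frame_subposet subposet_simps)
qed

end
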